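(* Let $X$, $(\Omega,\mathcal F,\mathbb P,\sigma)$, $A$, $\Pi^1,\Pi^2,\Pi^3$, $\lambda$, $K$, $\rho$, $Z$ be as described in the context (in particular $A(\omega)$ is invertible for $\mathbb P$-a.e. $\omega$, and $\lVert\mathcal A(\omega,n)\rVert\le Z(\omega)e^{\rho|n|}$ for $\mathbb P$-a.e. $\omega$ and all $n\in\mathbb Z$), let $\alpha_0:=\lambda/\rho\in(0,1]$, let $D\colon\Omega\to[1,\infty)$ be a tempered measurable map, and let $c>0$ be small enough for the linearization fact recalled in the context to hold. Let $\alpha\in(0,\alpha_0)$. Then there exists a tempered random variable $d\colon\Omega\to(0,+\infty)$ such that, for every $(c,D)$-admissible pair $(f_\omega)_{\omega\in\Omega}$, $(g_\omega)_{\omega\in\Omega}$ (in the sense of the context) satisfying $$|f_\omega(x)-f_\omega(z)|\le d(\omega)|x-z|\quad\text{and}\quad|g_\omega(x)-g_\omega(z)|\le d(\omega)|x-z|$$ for $\mathbb P$-a.e. $\omega\in\Omega$ and every $x,z\in X$, the conjugacies $H_\omega$ given by the linearization fact, and their inverses $H_\omega^{-1}$, are $\alpha$-Hölder continuous when restricted to bounded subsets of $X$, for $\mathbb P$-a.e. $\omega\in\Omega$. More precisely, given a bounded subset $\tilde X\subset X$, there exists a constant $T>0$ depending only on $\tilde X$ such that $$|H_\omega(x)-H_\omega(z)|\le T|x-z|^\alpha\quad\text{and}\quad|H_\omega^{-1}(x)-H_\omega^{-1}(z)|\le T|x-z|^\alpha$$ for $\mathbb P$-a.e. $\omega\in\Omega$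 and every $x,z\in\tilde X$.
   Context: Let $X=(X,|\cdot|)$ be an arbitrary Banach space, $\mathcal B(X)$ the space of bounded linear operators on $X$ with operator norm $\lVert\cdot\rVert$, $(\Omega,\mathcal F,\mathbb P)$ a probability space, and $\sigma\colon\Omega\to\Omega$ an invertible measurable $\mathbb P$-preserving transformation, with $\mathbb P$ ergodic. For $h\colon X\to X$ put $\lVert h\rVert_\infty:=\sup_{x\in X}|h(x)|$. Tempered: a measurable map $K\colon\Omega\to(0,\infty)$ is tempered if $\lim_{n\to\pm\infty}\frac1n\log K(\sigma^n(\omega))=0$ for $\mathbb P$-a.e. $\omega$. Strongly measurable: $B\colon\Omega\to\mathcal B(X)$ is strongly measurable if $\omega\mapsto B(\omega)x$ is measurable for each $x\in X$. Linear system. $A\colon\Omega\to\mathcal B(X)$ is strongly measurable and $A(\omega)$ is invertible for $\mathbb P$-a.e. $\omega$. Put $\mathcal A(\omega,n)=A(\sigma^{n-1}(\omega))\cdots A(\omega)$ for $n>0$, $\mathcal A(\omega,0)=\mathrm{Id}$, $\mathcal A(\omega,n)=A(\sigma^{-|n|}(\omega))^{-1}\cdots A(\sigma^{-1}(\omega))^{-1}$ for $n<0$. It is assumed that: - there are three strongly measurable families of projections $(\Pi^i(\omega))_{\omega\in\Omega}$, $i\in\{1,2,3\}$, on $X$ with $\mathrm{Id}=\Pi^1(\omega)+\Pi^2(\omega)+\Pi^3(\omega)$ for $\mathbb P$-a.e. $\omega$; - $A(\omega)\Pi^i(\omega)=\Pi^i(\sigma(\omega))A(\omega)$ for $i\in\{1,2,3\}$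 and $\mathbb P$-a.e. $\omega$; - for $i\in\{2,3\}$ and $\mathbb P$-a.e. $\omega$, $A(\omega)|_{\operatorname{Im}\Pi^i(\omega)}\colon\operatorname{Im}\Pi^i(\omega)\to\operatorname{Im}\Pi^i(\sigma(\omega))$ is invertible; - $\lambda>0$ and $K\colon\Omega\to[1,\infty)$ is a tempered random variable such that for $\mathbb P$-a.e. $\omega$ and all $n\ge0$, $\lVert\mathcal A(\omega,n)\Pi^1(\omega)\rVert\le K(\omega)e^{-\lambda n}$ and $\lVert\mathcal A(\omega,-n)\Pi^3(\omega)\rVert\le K(\omega)e^{-\lambda n}$; - $\rho>0$ and $Z\colon\Omega\to[1,+\infty)$ is a tempered random variable such that $\lVert\mathcal A(\omega,n)\rVert\le Z(\omega)e^{\rho|n|}$ for $\mathbb P$-a.e. $\omega$ and all $n\in\mathbb Z$; moreover $\rho\ge\lambda$ and $K(\omega)\le Z(\omega)$ for $\mathbb P$-a.e. $\omega$. Put $E^{s,u}(\omega):=\operatorname{Ker}\Pi^2(\omega)$ and $E^c(\omega):=\operatorname{Im}\Pi^2(\omega)$. $(c,D)$-admissible pairs. For $c>0$ and a tempered measurable $D\colon\Omega\to[1,\infty)$, families $(f_\omega)_{\omega\in\Omega}$, $(g_\omega)_{\omega\in\Omega}$ of continuous maps $X\to X$ form a $(c,D)$-admissible pair if: - for $\mathbb P$-a.e. $\omega$ and every $x\in X$, $f_\omega(x),g_\omega(x)\in E^{s,u}(\sigma(\omega))$; - for every $x\in X$, $\omega\mapsto f_\omega(x)$ and $\omega\mapsto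 g_\omega(x)$ are measurable; - $\max\{\lVert f_\omega\rVert_\infty,\lVert g_\omega\rVert_\infty\}\le D(\omega)$ for $\mathbb P$-a.e. $\omega$; - for $\mathbb P$-a.e. $\omega$ and all $x,y\in X$, $|f_\omega(x)-f_\omega(y)|\le\frac{c}{K(\sigma(\omega))}|x-y|$ and $|g_\omega(x)-g_\omega(y)|\le\frac{c}{K(\sigma(\omega))}|x-y|$; - for $\mathbb P$-a.e. $\omega$ and every $y\in E^c(\omega)$, the maps $x\mapsto A(\omega)x+f_\omega(x+y)$ and $x\mapsto A(\omega)x+g_\omega(x+y)$ are invertible maps from $E^{s,u}(\omega)$ onto $E^{s,u}(\sigma(\omega))$. Linearization fact. For all sufficiently small $c>0$ and every $(c,D)$-admissible pair there is a family of homeomorphisms $(H_\omega)_{\omega\in\Omega}$ of $X$, unique up to changes on a $\mathbb P$-null set of $\omega$, such that: $H_{\sigma(\omega)}\circ(A(\omega)+f_\omega)=(A(\omega)+g_\omega)\circ H_\omega$ for $\mathbb P$-a.e. $\omega$; $\omega\mapsto H_\omega(x)$ is measurable for each $x\in X$; $\lVert H_\omega-\mathrm{Id}\rVert_\infty\le T(\omega)$ for $\mathbb P$-a.e. $\omega$, for some tempered random variable $T\colon\Omega\to(0,\infty)$; and $H_\omega(x)-x\in E^{s,u}(\omega)$ for $\mathbb P$-a.e. $\omega$ and every $x\in X$. These $H_\omega$ are the conjugacies meant in the claim. *)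

theory Defs
  imports "HOL-Probability.Probability"
begin

section \<open>The base dynamics\<close>

text \<open>As usual, an invertible measurable transformation is a bijection of the underlying set that
  is measurable together with its inverse.\<close>

definition base_inv :: "'w measure \<Rightarrow> ('w \<Rightarrow> 'w) \<Rightarrow> 'w \<Rightarrow> 'w" where
  "base_inv M \<sigma> = inv_into (space M) \<sigma>"

definition base_iter :: "'w measure \<Rightarrow> ('w \<Rightarrow> 'w) \<Rightarrow> int \<Rightarrow> 'w \<Rightarrow> 'w" where
  "base_iter M \<sigma> n = (if 0 \<le> n then \<sigma> ^^ nat n else base_inv M \<sigma> ^^ nat (- n))"

locale ergodic_system = prob_space M for M :: "'w measure" +
  fixes \<sigma> :: "'w \<Rightarrow> 'w"
  assumes base_bij: "bij_betw \<sigma> (space M) (space M)"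
    and base_measurable: "\<sigma> \<in> measurable M M"
    and base_inv_measurable: "base_inv M \<sigma> \<in> measurable M M"
    and base_preserving: "distr M M \<sigma> = M"
    and ergodic: "\<And>S. S \<in> sets M \<Longrightarrow> \<sigma> -` S \<inter> space M = S \<Longrightarrow> measure M S = 0 \<or> measure M S = 1"

definition tempered :: "'w measure \<Rightarrow> ('w \<Rightarrow> 'w) \<Rightarrow> ('w \<Rightarrow> real) \<Rightarrow> bool" where
  "tempered M \<sigma> K \<longleftrightarrow>
     K \<in> borel_measurable M \<and> (\<forall>\<omega>\<in>space M. 0 < K \<omega>) \<and>
     (AE \<omega> in M.
        ((\<lambda>n::int. ln (K (base_iter M \<sigma> n \<omega>)) / of_int n) \<longlongrightarrow> 0) at_top \<and>
        ((\<lambda>n::int. ln (K (base_iter M \<sigma> n \<omega>)) / of_int n) \<longlongrightarrow> 0) at_bot)"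


section \<open>Linear cocycles\<close>

definition strongly_measurable ::
    "'w measure \<Rightarrow> ('w \<Rightarrow> 'a::real_normed_vector \<Rightarrow>\<^sub>L 'a) \<Rightarrow> bool" where
  "strongly_measurable M B \<longleftrightarrow> (\<forall>x. (\<lambda>\<omega>. blinfun_apply (B \<omega>) x) \<in> borel_measurable M)"

definition op_inverse_of ::
    "('a::real_normed_vector \<Rightarrow>\<^sub>L 'a) \<Rightarrow> ('a \<Rightarrow>\<^sub>L 'a) \<Rightarrow> bool" where
  "op_inverse_of B C \<longleftrightarrow> B o\<^sub>L C = id_blinfun \<and> C o\<^sub>L B = id_blinfun"

definition op_invertible :: "('a::real_normed_vector \<Rightarrow>\<^sub>L 'a) \<Rightarrow> bool" where
  "op_invertible B \<longleftrightarrow> (\<exists>C. op_inverse_of B C)"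

text \<open>Only meaningful for invertible operators; the inverse is then unique.\<close>

definition op_inv :: "('a::real_normed_vector \<Rightarrow>\<^sub>L 'a) \<Rightarrow> 'a \<Rightarrow>\<^sub>L 'a" where
  "op_inv B = (THE C. op_inverse_of B C)"

primrec cocycle_fwd ::
    "('w \<Rightarrow> 'w) \<Rightarrow> ('w \<Rightarrow> 'a::real_normed_vector \<Rightarrow>\<^sub>L 'a) \<Rightarrow> 'w \<Rightarrow> nat \<Rightarrow> 'a \<Rightarrow>\<^sub>L 'a" where
  "cocycle_fwd \<sigma> A \<omega> 0 = id_blinfun"
| "cocycle_fwd \<sigma> A \<omega> (Suc n) = A ((\<sigma> ^^ n) \<omega>) o\<^sub>L cocycle_fwd \<sigma> A \<omega> n"

primrec cocycle_bwd ::
    "'w measure \<Rightarrow> ('w \<Rightarrow> 'w) \<Rightarrow> ('w \<Rightarrow> 'a::real_normed_vector \<Rightarrow>\<^sub>L 'a) \<Rightarrow> 'w \<Rightarrow> nat \<Rightarrow> 'a \<Rightarrow>\<^sub>L 'a"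
where
  "cocycle_bwd M \<sigma> A \<omega> 0 = id_blinfun"
| "cocycle_bwd M \<sigma> A \<omega> (Suc n) =
     op_inv (A ((base_inv M \<sigma> ^^ Suc n) \<omega>)) o\<^sub>L cocycle_bwd M \<sigma> A \<omega> n"

definition cocycle ::
    "'w measure \<Rightarrow> ('w \<Rightarrow> 'w) \<Rightarrow> ('w \<Rightarrow> 'a::real_normed_vector \<Rightarrow>\<^sub>L 'a) \<Rightarrow> 'w \<Rightarrow> int \<Rightarrow> 'a \<Rightarrow>\<^sub>L 'a"
where
  "cocycle M \<sigma> A \<omega> n =
     (if 0 \<le> n then cocycle_fwd \<sigma> A \<omega> (nat n) else cocycle_bwd M \<sigma> A \<omega> (nat (- n)))"

locale trichotomic_cocycle = ergodic_system M \<sigma>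
  for M :: "'w measure" and \<sigma> :: "'w \<Rightarrow> 'w" +
  fixes A :: "'w \<Rightarrow> 'a::banach \<Rightarrow>\<^sub>L 'a"
    and P :: "nat \<Rightarrow> 'w \<Rightarrow> 'a \<Rightarrow>\<^sub>L 'a"
    and lam rho :: real
    and K Z :: "'w \<Rightarrow> real"
  assumes A_strongly_measurable: "strongly_measurable M A"
    and A_invertible: "AE \<omega> in M. op_invertible (A \<omega>)"
    and P_strongly_measurable: "\<And>i. i \<in> {1, 2, 3} \<Longrightarrow> strongly_measurable M (P i)"
    and P_projection: "\<And>i \<omega>. i \<in> {1, 2, 3} \<Longrightarrow> \<omega> \<in> space M \<Longrightarrow> P i \<omega> o\<^sub>L P i \<omega> = P i \<omega>"
    and P_sum: "AE \<omega> in M. id_blinfun = P 1 \<omega> + P 2 \<omega> + P 3 \<omega>"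
    and P_invariant: "\<And>i. i \<in> {1, 2, 3} \<Longrightarrow> AE \<omega> in M. A \<omega> o\<^sub>L P i \<omega> = P i (\<sigma> \<omega>) o\<^sub>L A \<omega>"
    and A_invertible_on_range:
      "\<And>i. i \<in> {2, 3} \<Longrightarrow> AE \<omega> in M.
         bij_betw (blinfun_apply (A \<omega>)) (range (blinfun_apply (P i \<omega>)))
           (range (blinfun_apply (P i (\<sigma> \<omega>))))"
    and lam_pos: "0 < lam"
    and K_ge_1: "\<And>\<omega>. \<omega> \<in> space M \<Longrightarrow> 1 \<le> K \<omega>"
    and K_tempered: "tempered M \<sigma> K"
    and stable_bound: "AE \<omega> in M. \<forall>n::nat.
         norm (cocycle M \<sigma> A \<omega> (int n) o\<^sub>L P 1 \<omega>) \<le> K \<omega> * exp (- lam * real n)"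
    and unstable_bound: "AE \<omega> in M. \<forall>n::nat.
         norm (cocycle M \<sigma> A \<omega> (- int n) o\<^sub>L P 3 \<omega>) \<le> K \<omega> * exp (- lam * real n)"
    and rho_pos: "0 < rho"
    and Z_ge_1: "\<And>\<omega>. \<omega> \<in> space M \<Longrightarrow> 1 \<le> Z \<omega>"
    and Z_tempered: "tempered M \<sigma> Z"
    and growth_bound: "AE \<omega> in M. \<forall>n::int.
         norm (cocycle M \<sigma> A \<omega> n) \<le> Z \<omega> * exp (rho * \<bar>of_int n\<bar>)"
    and lam_le_rho: "lam \<le> rho"
    and K_le_Z: "AE \<omega> in M. K \<omega> \<le> Z \<omega>"

definition Esu :: "(nat \<Rightarrow> 'w \<Rightarrow> 'a::real_normed_vector \<Rightarrow>\<^sub>L 'a) \<Rightarrow> 'w \<Rightarrow> 'a set" where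
  "Esu P \<omega> = {x. blinfun_apply (P 2 \<omega>) x = 0}"

definition Ec :: "(nat \<Rightarrow> 'w \<Rightarrow> 'a::real_normed_vector \<Rightarrow>\<^sub>L 'a) \<Rightarrow> 'w \<Rightarrow> 'a set" where
  "Ec P \<omega> = range (blinfun_apply (P 2 \<omega>))"


section \<open>Admissible pairs and conjugacies\<close>

text \<open>The supremum is taken in the extended reals, so that it is infinite for unbounded maps.\<close>

definition sup_norm :: "('a::real_normed_vector \<Rightarrow> 'a) \<Rightarrow> ereal" where
  "sup_norm h = (SUP x. ereal (norm (h x)))"

definition admissible_pair ::
    "'w measure \<Rightarrow> ('w \<Rightarrow> 'w) \<Rightarrow> ('w \<Rightarrow> 'a::banach \<Rightarrow>\<^sub>L 'a) \<Rightarrow> (nat \<Rightarrow> 'w \<Rightarrow> 'a \<Rightarrow>\<^sub>L 'a) \<Rightarrow>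
     ('w \<Rightarrow> real) \<Rightarrow> real \<Rightarrow> ('w \<Rightarrow> real) \<Rightarrow> ('w \<Rightarrow> 'a \<Rightarrow> 'a) \<Rightarrow> ('w \<Rightarrow> 'a \<Rightarrow> 'a) \<Rightarrow> bool" where
  "admissible_pair M \<sigma> A P K c D f g \<longleftrightarrow>
     (\<forall>\<omega>\<in>space M. continuous_on UNIV (f \<omega>) \<and> continuous_on UNIV (g \<omega>)) \<and>
     (AE \<omega> in M. \<forall>x. f \<omega> x \<in> Esu P (\<sigma> \<omega>) \<and> g \<omega> x \<in> Esu P (\<sigma> \<omega>)) \<and>
     (\<forall>x. (\<lambda>\<omega>. f \<omega> x) \<in> borel_measurable M \<and> (\<lambda>\<omega>. g \<omega> x) \<in> borel_measurable M) \<and>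
     (AE \<omega> in M. max (sup_norm (f \<omega>)) (sup_norm (g \<omega>)) \<le> ereal (D \<omega>)) \<and>
     (AE \<omega> in M. \<forall>x y.
        norm (f \<omega> x - f \<omega> y) \<le> c / K (\<sigma> \<omega>) * norm (x - y) \<and>
        norm (g \<omega> x - g \<omega> y) \<le> c / K (\<sigma> \<omega>) * norm (x - y)) \<and>
     (AE \<omega> in M. \<forall>y\<in>Ec P \<omega>.
        bij_betw (\<lambda>x. blinfun_apply (A \<omega>) x + f \<omega> (x + y)) (Esu P \<omega>) (Esu P (\<sigma> \<omega>)) \<and>
        bij_betw (\<lambda>x. blinfun_apply (A \<omega>) x + g \<omega> (x + y)) (Esu P \<omega>) (Esu P (\<sigma> \<omega>)))"

definition linearizing_conjugacy ::
    "'w measure \<Rightarrow> ('w \<Rightarrow> 'w) \<Rightarrow> ('w \<Rightarrow> 'a::banach \<Rightarrow>\<^sub>L 'a) \<Rightarrow> (nat \<Rightarrow> 'w \<Rightarrow> 'a \<Rightarrow>\<^sub>L 'a) \<Rightarrow>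
     ('w \<Rightarrow> 'a \<Rightarrow> 'a) \<Rightarrow> ('w \<Rightarrow> 'a \<Rightarrow> 'a) \<Rightarrow> ('w \<Rightarrow> 'a \<Rightarrow> 'a) \<Rightarrow> bool" where
  "linearizing_conjugacy M \<sigma> A P f g H \<longleftrightarrow>
     (\<forall>\<omega>\<in>space M. \<exists>G. homeomorphism UNIV UNIV (H \<omega>) G) \<and>
     (AE \<omega> in M. H (\<sigma> \<omega>) \<circ> (\<lambda>x. blinfun_apply (A \<omega>) x + f \<omega> x) =
        (\<lambda>x. blinfun_apply (A \<omega>) x + g \<omega> x) \<circ> H \<omega>) \<and>
     (\<forall>x. (\<lambda>\<omega>. H \<omega> x) \<in> borel_measurable M) \<and>
     (\<exists>T. tempered M \<sigma> T \<and> (AE \<omega> in M. sup_norm (\<lambda>x. H \<omega> x - x) \<le> ereal (T \<omega>))) \<and>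
     (AE \<omega> in M. \<forall>x. H \<omega> x - x \<in> Esu P \<omega>)"

text \<open>The requirement that \<open>c\<close> is small enough for every \<open>(c, D)\<close>-admissible pair to have an
  essentially unique conjugacy. Since a \<open>(c', D)\<close>-admissible pair with \<open>c' \<le> c\<close> is also
  \<open>(c, D)\<close>-admissible, the property passes to all smaller constants.\<close>

definition small_for_linearization ::
    "'w measure \<Rightarrow> ('w \<Rightarrow> 'w) \<Rightarrow> ('w \<Rightarrow> 'a::banach \<Rightarrow>\<^sub>L 'a) \<Rightarrow> (nat \<Rightarrow> 'w \<Rightarrow> 'a \<Rightarrow>\<^sub>L 'a) \<Rightarrow>
     ('w \<Rightarrow> real) \<Rightarrow> ('w \<Rightarrow> real) \<Rightarrow> real \<Rightarrow> bool" where
  "small_for_linearization M \<sigma> A P K D c \<longleftrightarrow>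
     (\<forall>f g. admissible_pair M \<sigma> A P K c D f g \<longrightarrow>
        (\<exists>H. linearizing_conjugacy M \<sigma> A P f g H \<and>
           (\<forall>H'. linearizing_conjugacy M \<sigma> A P f g H' \<longrightarrow> (AE \<omega> in M. H' \<omega> = H \<omega>))))"

definition holder_on :: "real \<Rightarrow> 'a::real_normed_vector set \<Rightarrow> ('a \<Rightarrow> 'a) \<Rightarrow> bool" where
  "holder_on \<alpha> S h \<longleftrightarrow> (\<exists>C. \<forall>x\<in>S. \<forall>z\<in>S. norm (h x - h z) \<le> C * norm (x - z) powr \<alpha>)"

end

theory Submission
  imports Defs
begin

text \<open>Write \<open>h = H - id\<close>. Along a generic orbit, \<open>h\<close> satisfies
  \<open>h\<^sub>m\<^sub>+\<^sub>1(F\<^sub>m x) = A\<^sub>m h\<^sub>m(x) + g\<^sub>m(H\<^sub>m x) - f\<^sub>m(x)\<close>, and \<open>h\<close> takes values in the stable plus unstable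
  directions, so the difference \<open>h\<^sub>n(x) - h\<^sub>n(z)\<close> is a sum, over the whole orbit, of differences of
  the perturbations weighted by the rates of contraction. If
  \<open>|h\<^sub>m(x) - h\<^sub>m(z)| \<le> |x - z|\<^sup>\<alpha> + E e\<^bsup>\<epsilon>|m|\<^esup>\<close> at all times \<open>m\<close>, then inserting this bound in the sum,
  interpolating between the sup bounds and the small Lipschitz constants \<open>d\<close> of the perturbations,
  and using that orbits separate at rate at most \<open>\<rho> + \<epsilon>\<close> with \<open>\<alpha>(\<rho> + \<epsilon>) + \<epsilon> < \<lambda>\<close>, reproduces the bound with
  \<open>E\<close> halved. Temperedness of \<open>H - id\<close> provides the first \<open>E\<close>, and in the limit \<open>h\<close> is
  \<open>\<alpha>\<close>-Hoelder with constant \<open>1\<close>. The nonuniform constants are dominated by a slowly varying random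
  variable \<open>W\<close>, which \<open>d = (\<mu> / W\<^sup>3)\<^bsup>1/\<alpha>\<^esup>\<close> absorbs. The inverse of \<open>H\<close> solves the same problem with
  \<open>f\<close> and \<open>g\<close> exchanged.\<close>

section \<open>Perturbed nonautonomous dynamics along one orbit\<close>

text \<open>The sum includes the current term, so each step costs a factor
  \<open>1 / (1 - \<eta>)\<close>; with \<eta> = \<open>1 - exp (- eps)\<close> this is exactly
  \<open>exp eps\<close>. The induction runs on the right-hand side of the hypothesis, which
  dominates \<open>v j\<close>.\<close>

lemma discrete_gronwall:
  fixes v :: "nat \<Rightarrow> real"
  assumes "0 \<le> \<eta>" "\<eta> < 1" "0 \<le> a"
    and v: "\<And>j. v j \<le> a + \<eta> * (\<Sum>i\<le>j. v i)"
  shows "v j \<le> a * inverse (1 - \<eta>) ^ Suc j"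
proof -
  define q where "q = inverse (1 - \<eta>)"
  have q: "q * (1 - \<eta>) = 1" "0 < q" using assms by (auto simp: q_def)
  have le_q: "x \<le> s * q" if "x * (1 - \<eta>) \<le> s" for x s
    using that assms by (simp add: q_def inverse_eq_divide pos_le_divide_eq)
  have *: "a + \<eta> * (\<Sum>i\<le>j. v i) \<le> a * q ^ Suc j" for j
  proof (induction j)
    case 0
    have "v 0 * (1 - \<eta>) \<le> a" using v[of 0] by (simp add: algebra_simps)
    from le_q[OF this] have "v 0 \<le> a * q" .
    then have "a + \<eta> * v 0 \<le> a + \<eta> * (a * q)" using assms by (simp add: mult_left_mono)
    also have "\<dots> = a * (q * (1 - \<eta>)) + \<eta> * (a * q)" by (simp only: q)
    also have "\<dots> = a * q" by (simp add: algebra_simps)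
    finally show ?case by simp
  next
    case (Suc j)
    define s where "s = a + \<eta> * (\<Sum>i\<le>j. v i)"
    have "v (Suc j) * (1 - \<eta>) \<le> s" using v[of "Suc j"] by (simp add: s_def algebra_simps)
    from le_q[OF this] have "v (Suc j) \<le> s * q" .
    then have "\<eta> * v (Suc j) \<le> \<eta> * (s * q)" using assms by (simp add: mult_left_mono)
    then have "s + \<eta> * v (Suc j) \<le> s * (q * (1 - \<eta>)) + \<eta> * (s * q)" by (simp add: q)
    also have "\<dots> = s * q" by (simp add: algebra_simps)
    also have "\<dots> \<le> (a * q ^ Suc j) * q" using Suc q by (intro mult_right_mono) (auto simp: s_def)
    finally show ?case by (simp add: s_def algebra_simps)
  qed
  show ?thesis using v[of j] *[of j] unfolding q_def by linarith
qed

lemma sum_exp_le: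
  fixes \<kappa> :: real
  assumes "0 < \<kappa>"
  shows "(\<Sum>i<N. exp (- \<kappa> * real i)) \<le> 1 / (1 - exp (- \<kappa>))"
proof -
  have "(\<Sum>i<N. exp (- \<kappa> * real i)) = (\<Sum>i<N. exp (- \<kappa>) ^ i)"
    by (simp add: exp_of_nat_mult[symmetric] mult.commute)
  also have "\<dots> = (1 - exp (- \<kappa>) ^ N) / (1 - exp (- \<kappa>))"
    using assms by (subst geometric_sum) (auto simp: field_simps)
  also have "\<dots> \<le> 1 / (1 - exp (- \<kappa>))"
    using assms by (intro divide_right_mono) auto
  finally show ?thesis .
qed

text \<open>Split \<open>u\<close> as \<open>u powr (1 - \<alpha>) * u powr \<alpha>\<close> and use
  one bound in each factor; \<open>1 \<le> a\<close> permits rounding the first exponent up to 1.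
  This trades a sup bound against a Lipschitz bound to obtain a Hoelder bound.\<close>

lemma le_interpolation:
  fixes u a b \<alpha> :: real
  assumes "0 \<le> u" "u \<le> a" "u \<le> b" "0 < \<alpha>" "\<alpha> < 1" "1 \<le> a"
  shows "u \<le> a * b powr \<alpha>"
proof (cases "u = 0")
  case False
  then have "u = u powr (1 - \<alpha>) * u powr \<alpha>"
    using assms by (simp flip: powr_add)
  also have "\<dots> \<le> a powr (1 - \<alpha>) * b powr \<alpha>"
    using assms by (intro mult_mono powr_mono2) auto
  also have "\<dots> \<le> a powr 1 * b powr \<alpha>"
    using assms by (intro mult_right_mono powr_mono) auto
  finally show ?thesis using assms by simp
qed (use assms in auto)

lemma norm_le_of_eq_add_sum:
  fixes x :: "'a::real_normed_vector"
  assumes "x = u + (\<Sum>i\<in>I. h i)"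
  shows "norm x \<le> norm u + (\<Sum>i\<in>I. norm (h i))"
  unfolding assms by (intro norm_triangle_le add_left_mono norm_sum)

lemma norm_le_of_eq_diff_sum:
  fixes x :: "'a::real_normed_vector"
  assumes "x = u - (\<Sum>i\<in>I. h i)"
  shows "norm x \<le> norm u + (\<Sum>i\<in>I. norm (h i))"
  unfolding assms by (intro norm_triangle_le_diff add_left_mono norm_sum)

text \<open>Iterate forward from time \<open>n\<close> and choose successive preimages
  backward.\<close>

lemma ex_two_sided_orbit:
  fixes F :: "int \<Rightarrow> 'a \<Rightarrow> 'a"
  assumes "\<And>m. surj (F m)"
  obtains x where "x n = a" "\<And>m. x (m + 1) = F m (x m)"
proof -
  define X where "X = rec_nat a (\<lambda>j. F (n + int j))"
  define Y where "Y = rec_nat a (\<lambda>j. inv (F (n - int j - 1)))"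
  define x where "x m = (if n \<le> m then X (nat (m - n)) else Y (nat (n - m)))" for m
  have X: "X (Suc j) = F (n + int j) (X j)" for j by (simp add: X_def)
  have Y: "F (n - int j - 1) (Y (Suc j)) = Y j" for j
    by (simp add: Y_def surj_f_inv_f[OF assms])
  have XY: "X 0 = Y 0" by (simp add: X_def Y_def)
  have "x (m + 1) = F m (x m)" for m
  proof (cases "n \<le> m")
    case True
    then obtain j where j: "m = n + int j" using zle_iff_zadd by auto
    have "nat (m + 1 - n) = Suc j" "nat (m - n) = j" using j by auto
    then show ?thesis using True X[of j] j by (simp add: x_def)
  next
    case False
    define j where "j = nat (n - m - 1)"
    have j: "m = n - int j - 1" using False by (simp add: j_def)
    have e: "nat (n - m) = Suc j" using j by auto
    show ?thesis
    proof (cases j)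
      case 0
      then show ?thesis using j Y[of 0] XY by (simp add: x_def)
    next
      case (Suc k)
      have "nat (n - (m + 1)) = j" using j by auto
      then show ?thesis using e Y[of j] j Suc by (simp add: x_def)
    qed
  qed
  moreover have "x n = a" by (simp add: x_def X_def)
  ultimately show ?thesis using that by blast
qed

section \<open>Deterministic evolution families with a partial trichotomy\<close>

text \<open>This is what remains of the random cocycle once a generic orbit is fixed.
  \<open>U m n\<close> transports from time \<open>n\<close> to time \<open>m\<close>, in either
  direction. A single \<open>W\<close> replaces all nonuniform constants, and changing the time at
  which it is evaluated costs a factor \<open>exp eps\<close> per step.\<close>

locale slowly_varying_trichotomy =
  fixes U :: "int \<Rightarrow> int \<Rightarrow> 'a::real_normed_vector \<Rightarrow>\<^sub>L 'a"
    and Ps Pu :: "int \<Rightarrow> 'a \<Rightarrow>\<^sub>L 'a" and W :: "int \<Rightarrow> real" and lam rho eps :: real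
  assumes U_refl: "U n n = id_blinfun"
    and U_trans: "U l m o\<^sub>L U m n = U l n"
    and Ps_comm: "Ps m o\<^sub>L U m n = U m n o\<^sub>L Ps n"
    and Pu_comm: "Pu m o\<^sub>L U m n = U m n o\<^sub>L Pu n"
    and W_ge_1: "1 \<le> W n"
    and W_slow: "W n \<le> W m * exp (eps * \<bar>of_int (n - m)\<bar>)"
    and U_growth: "norm (U m n) \<le> W n * exp (rho * \<bar>of_int (m - n)\<bar>)"
    and stable: "norm (U (n + int k) n o\<^sub>L Ps n) \<le> W n * exp (- lam * real k)"
    and unstable: "norm (U (n - int k) n o\<^sub>L Pu n) \<le> W n * exp (- lam * real k)"
    and lam_pos: "0 < lam" and rho_pos: "0 < rho" and eps_pos: "0 < eps" and eps_less: "2 * eps < lam"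
begin

lemma W_nonneg: "0 \<le> W n" using W_ge_1[of n] by linarith

lemma U_trans_apply: "U l m (U m n x) = U l n x"
  using U_trans[of l m n] by (metis blinfun_apply_blinfun_compose)

lemma Ps_U: "Ps m (U m n x) = U m n (Ps n x)"
  using Ps_comm[of m n] by (metis blinfun_apply_blinfun_compose)

lemma Pu_U: "Pu m (U m n x) = U m n (Pu n x)"
  using Pu_comm[of m n] by (metis blinfun_apply_blinfun_compose)

text \<open>Everything is transported to a free time \<open>l\<close>: with \<open>l\<close> the
  later time this describes the forward evolution, with \<open>l = n\<close> it recovers the present
  state from the future.\<close>

lemma variation_of_constants:
  assumes y: "\<And>m. y (m + 1) = U (m + 1) m (y m) + p m"
  shows "U l (n + int N) (y (n + int N)) = U l n (y n) + (\<Sum>i<N. U l (n + int i + 1) (p (n + int i)))"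
proof (induction N)
  case (Suc N)
  have "U l (n + int N + 1) (y (n + int N + 1)) = U l (n + int N) (y (n + int N)) + U l (n + int N + 1) (p (n + int N))"
    by (simp add: y blinfun.add_right U_trans_apply)
  then show ?case using Suc by (simp add: add_ac)
qed simp

lemma variation_of_constants_past:
  assumes y: "\<And>m. y (m + 1) = U (m + 1) m (y m) + p m"
  shows "U l n (y n) = U l (n - int N) (y (n - int N)) + (\<Sum>i<N. U l (n - int i) (p (n - int i - 1)))"
proof (induction N)
  case (Suc N)
  have "U l (n - int N) (y (n - int N)) = U l (n - int N - 1) (y (n - int N - 1)) + U l (n - int N) (p (n - int N - 1))"
    using y[of "n - int N - 1"] by (simp add: blinfun.add_right U_trans_apply)
  then show ?case using Suc by (simp add: algebra_simps)
qed simp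

text \<open>The difference of two perturbed orbits solves the linear equation up to an error of
  relative size \<open>d\<close>. Smallness of \<open>d\<close> against \<open>W\<close> lets
  Gronwall raise the rate only from \<open>rho\<close> to \<open>rho + eps\<close>, in both time
  directions.\<close>

lemma perturbed_orbit_growth:
  assumes \<Delta>: "\<And>m. \<Delta> (m + 1) = U (m + 1) m (\<Delta> m) + r m"
    and r: "\<And>m. norm (r m) \<le> d m * norm (\<Delta> m)"
    and d: "\<And>m. 0 \<le> d m" "\<And>m. exp (rho + eps) * W m * d m \<le> 1 - exp (- eps)"
  shows "norm (\<Delta> m) \<le> W n * exp ((rho + eps) * \<bar>of_int (m - n)\<bar> + eps) * norm (\<Delta> n)"
proof -
  define \<eta> where "\<eta> = 1 - exp (- eps)"
  have \<eta>: "0 \<le> \<eta>" "\<eta> < 1"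
    using eps_pos by (auto simp: \<eta>_def)
  have inv_\<eta>: "inverse (1 - \<eta>) = exp eps"
    by (simp add: \<eta>_def exp_minus)
  \<comment> \<open>The error made at \<open>m\<close> enters at \<open>m + 1\<close>. Backward from
    \<open>n\<close> this is one step closer to \<open>n\<close> than \<open>m\<close>, so the
    transport is one step longer than the weights allow; the factor \<open>exp (- rho)\<close> pays
    for it. Forward it is a surplus.\<close>
  have r': "W (m + 1) * norm (r m) \<le> exp (- rho) * \<eta> * norm (\<Delta> m)" for m
  proof -
    have "W (m + 1) * norm (r m) \<le> (W m * exp eps) * (d m * norm (\<Delta> m))"
      using W_slow[of "m + 1" m] r[of m] W_nonneg by (intro mult_mono) auto
    also have "\<dots> = exp (- rho) * (exp (rho + eps) * W m * d m) * norm (\<Delta> m)"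
      by (simp add: exp_add exp_minus)
    also have "\<dots> \<le> exp (- rho) * \<eta> * norm (\<Delta> m)"
      using d(2)[of m] by (intro mult_right_mono mult_left_mono) (auto simp: \<eta>_def)
    finally show ?thesis .
  qed
  have Ur: "norm (U l (m + 1) (r m)) \<le> exp (rho * (\<bar>of_int (l - (m + 1))\<bar> - 1)) * \<eta> * norm (\<Delta> m)" for l m
  proof -
    have "norm (U l (m + 1) (r m)) \<le> norm (U l (m + 1)) * norm (r m)" by (rule norm_blinfun)
    also have "\<dots> \<le> W (m + 1) * exp (rho * \<bar>of_int (l - (m + 1))\<bar>) * norm (r m)"
      by (rule mult_right_mono[OF U_growth]) simp
    also have "\<dots> = exp (rho * \<bar>of_int (l - (m + 1))\<bar>) * (W (m + 1) * norm (r m))" by simp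
    also have "\<dots> \<le> exp (rho * \<bar>of_int (l - (m + 1))\<bar>) * (exp (- rho) * \<eta> * norm (\<Delta> m))"
      by (rule mult_left_mono[OF r']) simp
    also have "\<dots> = exp (rho * (\<bar>of_int (l - (m + 1))\<bar> - 1)) * \<eta> * norm (\<Delta> m)"
      by (simp add: algebra_simps flip: exp_add)
    finally show ?thesis .
  qed
  have U0: "norm (U m n (\<Delta> n)) \<le> W n * exp (rho * \<bar>of_int (m - n)\<bar>) * norm (\<Delta> n)" for m
    by (rule order_trans[OF norm_blinfun mult_right_mono[OF U_growth]]) simp
  have gronwall: "v j \<le> W n * norm (\<Delta> n) * exp (eps * (real j + 1))"
    if "\<And>j. v j \<le> W n * norm (\<Delta> n) + \<eta> * (\<Sum>i\<le>j. v i)" for v :: "nat \<Rightarrow> real" and j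
    using discrete_gronwall[OF \<eta> _ that, of j] W_nonneg[of n]
    unfolding inv_\<eta> exp_of_nat_mult[symmetric] by (simp add: algebra_simps)
  have fin: "norm (\<Delta> m) \<le> W n * exp ((rho + eps) * \<bar>of_int (m - n)\<bar> + eps) * norm (\<Delta> n)"
    if "v j = exp (- rho * real j) * norm (\<Delta> m)" "\<bar>m - n\<bar> = int j"
      "\<And>j. v j \<le> W n * norm (\<Delta> n) + \<eta> * (\<Sum>i\<le>j. v i)" for v :: "nat \<Rightarrow> real" and j
  proof -
    have j: "\<bar>of_int (m - n)\<bar> = real j" using that(2) by (metis of_int_abs of_int_of_nat_eq)
    have "norm (\<Delta> m) = exp (rho * real j) * v j"
      by (simp add: that(1) exp_minus)
    also have "\<dots> \<le> exp (rho * real j) * (W n * norm (\<Delta> n) * exp (eps * (real j + 1)))"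
      by (rule mult_left_mono[OF gronwall[OF that(3)]]) simp
    also have "\<dots> = W n * exp ((rho + eps) * real j + eps) * norm (\<Delta> n)"
      by (simp add: exp_add algebra_simps)
    finally show ?thesis unfolding j .
  qed
  show ?thesis
  proof (cases "n \<le> m")
    case True
    then obtain j where j: "m = n + int j" using zle_iff_zadd by auto
    \<comment> \<open>Rescaling removes the linear growth, leaving a Gronwall inequality with the
      constant coefficient \<eta>.\<close>
    define v where "v i = exp (- rho * real i) * norm (\<Delta> (n + int i))" for i :: nat
    have "v j \<le> W n * norm (\<Delta> n) + \<eta> * (\<Sum>i\<le>j. v i)" for j
    proof -
      have "\<Delta> (n + int j) = U (n + int j) n (\<Delta> n) + (\<Sum>i<j. U (n + int j) (n + int i + 1) (r (n + int i)))"
        using variation_of_constants[OF \<Delta>, of "n + int j" n j] by (simp add: U_refl)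
      then have "norm (\<Delta> (n + int j)) \<le> norm (U (n + int j) n (\<Delta> n)) + (\<Sum>i<j. norm (U (n + int j) (n + int i + 1) (r (n + int i))))"
        by (rule norm_le_of_eq_add_sum)
      also have "\<dots> \<le> W n * exp (rho * real j) * norm (\<Delta> n)
          + (\<Sum>i<j. exp (rho * (real j - real i)) * \<eta> * norm (\<Delta> (n + int i)))"
      proof (intro add_mono sum_mono)
        show "norm (U (n + int j) n (\<Delta> n)) \<le> W n * exp (rho * real j) * norm (\<Delta> n)"
          using U0[of "n + int j"] by simp
        fix i assume "i \<in> {..<j}"
        then have "norm (U (n + int j) (n + int i + 1) (r (n + int i)))
           \<le> exp (rho * (real j - real i - 2)) * \<eta> * norm (\<Delta> (n + int i))"
          using Ur[of "n + int j" "n + int i"] by (simp add: abs_if split: if_splits)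
        also have "\<dots> \<le> exp (rho * (real j - real i)) * \<eta> * norm (\<Delta> (n + int i))"
          using \<eta> rho_pos by (intro mult_right_mono) auto
        finally show "norm (U (n + int j) (n + int i + 1) (r (n + int i)))
           \<le> exp (rho * (real j - real i)) * \<eta> * norm (\<Delta> (n + int i))" .
      qed
      finally have "v j \<le> exp (- rho * real j) * (W n * exp (rho * real j) * norm (\<Delta> n)
          + (\<Sum>i<j. exp (rho * (real j - real i)) * \<eta> * norm (\<Delta> (n + int i))))"
        unfolding v_def by (intro mult_left_mono) auto
      also have "\<dots> = W n * norm (\<Delta> n) + \<eta> * (\<Sum>i<j. v i)"
        by (simp add: v_def sum_distrib_left distrib_left exp_minus right_diff_distrib exp_diff divide_simps mult_ac)
      also have "\<dots> \<le> W n * norm (\<Delta> n) + \<eta> * (\<Sum>i\<le>j. v i)"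
        using \<eta> by (intro add_left_mono mult_left_mono sum_mono2) (auto simp: v_def)
      finally show ?thesis .
    qed
    then show ?thesis using j by (intro fin[of v j]) (auto simp: v_def)
  next
    case False
    then have "m \<le> n" by simp
    then obtain j where "n = m + int j" using zle_iff_zadd by auto
    then have j: "m = n - int j" by simp
    define v where "v i = exp (- rho * real i) * norm (\<Delta> (n - int i))" for i :: nat
    have "v j \<le> W n * norm (\<Delta> n) + \<eta> * (\<Sum>i\<le>j. v i)" for j
    proof -
      have "\<Delta> (n - int j) = U (n - int j) n (\<Delta> n) - (\<Sum>i<j. U (n - int j) (n - int i) (r (n - int i - 1)))"
        using variation_of_constants_past[OF \<Delta>, of "n - int j" n j] by (simp add: U_refl)
      then have "norm (\<Delta> (n - int j)) \<le> norm (U (n - int j) n (\<Delta> n)) + (\<Sum>i<j. norm (U (n - int j) (n - int i) (r (n - int i - 1))))"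
        by (rule norm_le_of_eq_diff_sum)
      also have "\<dots> \<le> W n * exp (rho * real j) * norm (\<Delta> n)
          + (\<Sum>i<j. exp (rho * (real j - real (Suc i))) * \<eta> * norm (\<Delta> (n - int (Suc i))))"
      proof (intro add_mono sum_mono)
        show "norm (U (n - int j) n (\<Delta> n)) \<le> W n * exp (rho * real j) * norm (\<Delta> n)"
          using U0[of "n - int j"] by simp
        fix i assume "i \<in> {..<j}"
        then have i: "i < j" by simp
        have e1: "n - int i - 1 + 1 = n - int i" "n - int (Suc i) = n - int i - 1" by auto
        have e: "\<bar>of_int (n - int j - (n - int i))\<bar> - 1 = real j - real (Suc i)" using i by (simp add: abs_if)
        show "norm (U (n - int j) (n - int i) (r (n - int i - 1)))
           \<le> exp (rho * (real j - real (Suc i))) * \<eta> * norm (\<Delta> (n - int (Suc i)))"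
          using Ur[of "n - int j" "n - int i - 1"] unfolding e1 e .
      qed
      finally have "v j \<le> exp (- rho * real j) * (W n * exp (rho * real j) * norm (\<Delta> n)
          + (\<Sum>i<j. exp (rho * (real j - real (Suc i))) * \<eta> * norm (\<Delta> (n - int (Suc i)))))"
        unfolding v_def by (intro mult_left_mono) auto
      also have "\<dots> = W n * norm (\<Delta> n) + \<eta> * (\<Sum>i<j. v (Suc i))"
        by (simp del: of_nat_Suc add: v_def sum_distrib_left distrib_left exp_minus right_diff_distrib exp_diff divide_simps mult_ac)
      also have "(\<Sum>i<j. v (Suc i)) = sum v {1..j}"
        by (simp add: sum.atLeast_Suc_lessThan lessThan_atLeast0 flip: sum.shift_bounds_Suc_ivl atLeastLessThanSuc_atLeastAtMost)
      also have "W n * norm (\<Delta> n) + \<eta> * \<dots> \<le> W n * norm (\<Delta> n) + \<eta> * (\<Sum>i\<le>j. v i)"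
        using \<eta> by (intro add_left_mono mult_left_mono sum_mono2) (auto simp: v_def)
      finally show ?thesis .
    qed
    then show ?thesis using j by (intro fin[of v j]) (auto simp: v_def)
  qed
qed

lemma tempered_remainder_tendsto_0:
  "(\<lambda>N. W n * C * exp (eps * \<bar>of_int n\<bar>) * exp (- (lam - 2 * eps) * real N)) \<longlonglongrightarrow> 0"
proof -
  have "(\<lambda>N. exp (- (lam - 2 * eps)) ^ N) \<longlonglongrightarrow> 0"
    using eps_less by (intro LIMSEQ_realpow_zero) auto
  then have "(\<lambda>N. exp (- (lam - 2 * eps) * real N)) \<longlonglongrightarrow> 0"
    by (simp add: exp_of_nat_mult[symmetric] mult.commute)
  from tendsto_mult_left[OF this] show ?thesis by simp
qed

text \<open>The stable component is recovered from the past and the unstable one from the future. As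
  the horizon \<open>N\<close> grows, the boundary terms vanish, because \<open>y\<close> and
  \<open>W\<close> grow too slowly to offset the contraction, and what is left are two geometric
  sums of ratio \<open>exp (- \<kappa>)\<close>.\<close>

lemma trichotomy_estimate:
  assumes y: "\<And>m. y (m + 1) = U (m + 1) m (y m) + p m"
    and C: "\<And>m. norm (y m) \<le> C * exp (eps * \<bar>of_int m\<bar>)"
    and split: "y n = Ps n (y n) + Pu n (y n)"
    and p: "\<And>m. exp (lam + eps) * W m * norm (p m) \<le> Q * exp ((lam - \<kappa>) * \<bar>of_int (m - n)\<bar>)"
    and \<kappa>: "0 < \<kappa>"
  shows "norm (y n) \<le> 2 / (1 - exp (- \<kappa>)) * Q"
proof -
  \<comment> \<open>Common bound for both boundary terms: of the rate \<open>lam\<close>, one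
    \<open>eps\<close> is lost to the variation of \<open>W\<close> and one to the growth of
    \<open>y\<close>.\<close>
  define R where "R N = W n * C * exp (eps * \<bar>of_int n\<bar>) * exp (- (lam - 2 * eps) * real N)" for N
  have R: "R \<longlonglongrightarrow> 0" unfolding R_def by (rule tempered_remainder_tendsto_0)
  have C0: "0 \<le> C" using order_trans[OF norm_ge_zero C[of 0]] by simp
  have "0 \<le> exp (lam + eps) * W n * norm (p n)" using W_nonneg[of n] by simp
  with p[of n] have Q0: "0 \<le> Q" by simp
  have rem: "W m * exp (- lam * real N) * norm (y m) \<le> R N" if "\<bar>m - n\<bar> = int N" for m N
  proof -
    have mn: "\<bar>of_int (m - n)\<bar> = real N" using that by (metis of_int_abs of_int_of_nat_eq)
    have "\<bar>real_of_int m\<bar> \<le> \<bar>of_int n\<bar> + real N" using mn by simp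
    then have "C * exp (eps * \<bar>of_int m\<bar>) \<le> C * exp (eps * (\<bar>of_int n\<bar> + real N))"
      using eps_pos C0 by (intro mult_left_mono) auto
    with C[of m] have "norm (y m) \<le> C * exp (eps * (\<bar>of_int n\<bar> + real N))" by linarith
    moreover have "W m \<le> W n * exp (eps * real N)" using W_slow[of m n] unfolding mn .
    ultimately have "W m * exp (- lam * real N) * norm (y m)
      \<le> (W n * exp (eps * real N)) * exp (- lam * real N) * (C * exp (eps * (\<bar>of_int n\<bar> + real N)))"
      using W_nonneg C0 by (intro mult_mono) auto
    also have "\<dots> = W n * C * exp (eps * real N + - lam * real N + eps * (\<bar>of_int n\<bar> + real N))"
      unfolding exp_add by (simp add: mult_ac)
    also have "\<dots> = R N"
      unfolding R_def mult.assoc exp_add[symmetric] by (simp add: algebra_simps)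
    finally show ?thesis .
  qed
  \<comment> \<open>The factor \<open>exp (lam + eps)\<close> in the hypothesis on \<open>p\<close>
    is spent here: \<open>exp eps\<close> moves \<open>W\<close> to \<open>m + 1\<close>, and
    \<open>exp (- lam)\<close> makes up for the past terms, which lie at distance
    \<open>i + 1\<close> but have been contracted only \<open>i\<close> times.\<close>
  have Wp: "W (m + 1) * norm (p m) \<le> exp (- lam) * Q * exp ((lam - \<kappa>) * real k)"
    if "\<bar>m - n\<bar> = int k" for m k
  proof -
    have mn: "\<bar>of_int (m - n)\<bar> = real k" using that by (metis of_int_abs of_int_of_nat_eq)
    have "W (m + 1) * norm (p m) \<le> (W m * exp eps) * norm (p m)"
      using W_slow[of "m + 1" m] by (intro mult_right_mono) auto
    also have "\<dots> = exp (- lam) * (exp (lam + eps) * W m * norm (p m))"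
      by (simp add: exp_add exp_minus)
    also have "\<dots> \<le> exp (- lam) * (Q * exp ((lam - \<kappa>) * real k))"
      using p[of m] unfolding mn by (intro mult_left_mono) auto
    finally show ?thesis by (simp add: mult_ac)
  qed
  have sums: "(\<Sum>i<N. Q * exp (- \<kappa> * real i)) \<le> Q / (1 - exp (- \<kappa>))" for N
    using mult_left_mono[OF sum_exp_le[OF \<kappa>, of N] Q0] by (simp add: sum_distrib_left)
  have s: "norm (Ps n (y n)) \<le> R N + Q / (1 - exp (- \<kappa>))" for N
  proof -
    have B: "norm (Ps n (U n (n - int k) x)) \<le> W (n - int k) * exp (- lam * real k) * norm x" for k x
    proof -
      have "norm (Ps n (U n (n - int k) x)) = norm ((U n (n - int k) o\<^sub>L Ps (n - int k)) x)"
        by (simp add: Ps_U)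
      also have "\<dots> \<le> norm (U n (n - int k) o\<^sub>L Ps (n - int k)) * norm x" by (rule norm_blinfun)
      also have "\<dots> \<le> W (n - int k) * exp (- lam * real k) * norm x"
        using stable[of "n - int k" k] by (intro mult_right_mono) auto
      finally show ?thesis .
    qed
    have "Ps n (y n) = Ps n (U n (n - int N) (y (n - int N))) + (\<Sum>i<N. Ps n (U n (n - int i) (p (n - int i - 1))))"
      using variation_of_constants_past[OF y, of n n N]
      by (simp add: U_refl blinfun.add_right blinfun.sum_right)
    then have "norm (Ps n (y n)) \<le> norm (Ps n (U n (n - int N) (y (n - int N)))) + (\<Sum>i<N. norm (Ps n (U n (n - int i) (p (n - int i - 1)))))"
      by (rule norm_le_of_eq_add_sum)
    also have "\<dots> \<le> R N + (\<Sum>i<N. Q * exp (- \<kappa> * real i))"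
    proof (intro add_mono sum_mono)
      show "norm (Ps n (U n (n - int N) (y (n - int N)))) \<le> R N"
        by (rule order_trans[OF B rem]) simp
      fix i
      have "norm (Ps n (U n (n - int i) (p (n - int i - 1))))
         \<le> exp (- lam * real i) * (W (n - int i - 1 + 1) * norm (p (n - int i - 1)))"
        using B[of i "p (n - int i - 1)"] by (simp add: mult_ac)
      also have "\<dots> \<le> exp (- lam * real i) * (exp (- lam) * Q * exp ((lam - \<kappa>) * real (Suc i)))"
        by (intro mult_left_mono Wp) auto
      also have "\<dots> = Q * exp (- \<kappa> * real (Suc i))"
        by (simp add: algebra_simps flip: exp_add)
      also have "\<dots> \<le> Q * exp (- \<kappa> * real i)"
        using Q0 \<kappa> by (intro mult_left_mono) auto
      finally show "norm (Ps n (U n (n - int i) (p (n - int i - 1)))) \<le> Q * exp (- \<kappa> * real i)" .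
    qed
    finally show ?thesis using sums[of N] by linarith
  qed
  have u: "norm (Pu n (y n)) \<le> R N + Q / (1 - exp (- \<kappa>))" for N
  proof -
    have B: "norm (Pu n (U n (n + int k) x)) \<le> W (n + int k) * exp (- lam * real k) * norm x" for k x
    proof -
      have "norm (Pu n (U n (n + int k) x)) = norm ((U n (n + int k) o\<^sub>L Pu (n + int k)) x)"
        by (simp add: Pu_U)
      also have "\<dots> \<le> norm (U n (n + int k) o\<^sub>L Pu (n + int k)) * norm x" by (rule norm_blinfun)
      also have "\<dots> \<le> W (n + int k) * exp (- lam * real k) * norm x"
        using unstable[of "n + int k" k] by (intro mult_right_mono) auto
      finally show ?thesis .
    qed
    have "Pu n (y n) = Pu n (U n (n + int N) (y (n + int N))) - (\<Sum>i<N. Pu n (U n (n + int i + 1) (p (n + int i))))"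
      using variation_of_constants[OF y, of n n N]
      by (simp add: U_refl blinfun.add_right blinfun.sum_right)
    then have "norm (Pu n (y n)) \<le> norm (Pu n (U n (n + int N) (y (n + int N)))) + (\<Sum>i<N. norm (Pu n (U n (n + int i + 1) (p (n + int i)))))"
      by (rule norm_le_of_eq_diff_sum)
    also have "\<dots> \<le> R N + (\<Sum>i<N. Q * exp (- \<kappa> * real i))"
    proof (intro add_mono sum_mono)
      show "norm (Pu n (U n (n + int N) (y (n + int N)))) \<le> R N"
        by (rule order_trans[OF B rem]) simp
      fix i
      have "norm (Pu n (U n (n + int i + 1) (p (n + int i))))
         \<le> exp (- lam * real (Suc i)) * (W (n + int i + 1) * norm (p (n + int i)))"
        using B[of "Suc i" "p (n + int i)"] by (simp add: mult_ac add_ac)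
      also have "\<dots> \<le> exp (- lam * real (Suc i)) * (exp (- lam) * Q * exp ((lam - \<kappa>) * real i))"
        by (intro mult_left_mono Wp) auto
      also have "\<dots> = Q * exp (- 2 * lam - \<kappa> * real i)"
        by (simp add: algebra_simps flip: exp_add)
      also have "\<dots> \<le> Q * exp (- \<kappa> * real i)"
        using Q0 lam_pos by (intro mult_left_mono) auto
      finally show "norm (Pu n (U n (n + int i + 1) (p (n + int i)))) \<le> Q * exp (- \<kappa> * real i)" .
    qed
    finally show ?thesis using sums[of N] by linarith
  qed
  have "norm (y n) \<le> 2 / (1 - exp (- \<kappa>)) * Q + 2 * R N" for N
  proof -
    have "norm (y n) \<le> norm (Ps n (y n)) + norm (Pu n (y n))"
      by (metis split norm_triangle_ineq)
    then show ?thesis using s[of N] u[of N] by simp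
  qed
  moreover have "(\<lambda>N. 2 / (1 - exp (- \<kappa>)) * Q + 2 * R N) \<longlonglongrightarrow> 2 / (1 - exp (- \<kappa>)) * Q + 2 * 0"
    by (intro tendsto_intros R)
  ultimately show ?thesis by (intro LIMSEQ_le_const) auto
qed

text \<open>No regularity of \<open>H\<close> is assumed: the bound is bootstrapped from \<open>tame\<close>, the error
  \<open>2 C e\<^bsup>\<epsilon>|n|\<^esup>\<close> being halved in each step of the induction in \<open>approx\<close>.\<close>

lemma conjugacy_holder:
  fixes f g H :: "int \<Rightarrow> 'a \<Rightarrow> 'a"
  assumes conj: "\<And>m x. H (m + 1) (U (m + 1) m x + f m x) = U (m + 1) m (H m x) + g m (H m x)"
    and surj: "\<And>m. surj (\<lambda>x. U (m + 1) m x + f m x)"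
    and bdd: "\<And>m x. norm (f m x) \<le> W m" "\<And>m x. norm (g m x) \<le> W m"
    and lip: "\<And>m x z. norm (f m x - f m z) \<le> d m * norm (x - z)"
      "\<And>m x z. norm (g m x - g m z) \<le> d m * norm (x - z)"
    and split: "\<And>m x. H m x - x = Ps m (H m x - x) + Pu m (H m x - x)"
    and tame: "\<And>m x. norm (H m x - x) \<le> C * exp (eps * \<bar>of_int m\<bar>)"
    and \<alpha>: "0 < \<alpha>" "\<alpha> < 1"
    and \<kappa>: "0 < \<kappa>" "\<kappa> = lam - \<alpha> * (rho + eps) - eps"
    and d: "\<And>m. 0 < d m" "\<And>m. d m \<le> 1"
    and d_growth: "\<And>m. exp (rho + eps) * W m * d m \<le> 1 - exp (- eps)"
    and d_small: "\<And>m. 5 * exp (lam + 2 * eps) * W m ^ 3 * d m powr \<alpha> \<le> (1 - exp (- \<kappa>)) / 4"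
  shows "norm ((H n x - x) - (H n z - z)) \<le> norm (x - z) powr \<alpha>"
proof -
  have C0: "0 \<le> C" using order_trans[OF norm_ge_zero tame[of 0 undefined]] by simp
  have approx: "norm ((H n x - x) - (H n z - z))
      \<le> norm (x - z) powr \<alpha> + 2 * C / 2 ^ k * exp (eps * \<bar>of_int n\<bar>)" for k n x z
  proof (induction k arbitrary: n x z)
    case 0
    have "norm ((H n x - x) - (H n z - z)) \<le> norm (H n x - x) + norm (H n z - z)"
      by (rule norm_triangle_ineq4)
    then show ?case using tame[of n x] tame[of n z] by (simp add: add_increasing)
  next
    case (Suc k)
    define E where "E = 2 * C / 2 ^ k"
    have E0: "0 \<le> E" using C0 by (simp add: E_def)
    \<comment> \<open>The comparison runs along the full perturbed orbits through \<open>x\<close>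
      and \<open>z\<close>; surjectivity supplies their pasts.\<close>
    obtain X where X: "X n = x" "\<And>m. X (m + 1) = U (m + 1) m (X m) + f m (X m)"
      using ex_two_sided_orbit[of "\<lambda>m x. U (m + 1) m x + f m x" n x] surj by blast
    obtain Y where Y: "Y n = z" "\<And>m. Y (m + 1) = U (m + 1) m (Y m) + f m (Y m)"
      using ex_two_sided_orbit[of "\<lambda>m x. U (m + 1) m x + f m x" n z] surj by blast
    define t where "t m = norm (X m - Y m)" for m
    define y where "y m = (H m (X m) - X m) - (H m (Y m) - Y m)" for m
    define p where "p m = (g m (H m (X m)) - g m (H m (Y m))) - (f m (X m) - f m (Y m))" for m
    have t0: "t n = norm (x - z)" by (simp add: t_def X Y)
    have yrec: "y (m + 1) = U (m + 1) m (y m) + p m" for m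
      using conj[of m "X m"] conj[of m "Y m"]
      by (simp add: y_def p_def X(2)[of m] Y(2)[of m] blinfun.diff_right)
    have growth: "t m \<le> W n * exp ((rho + eps) * \<bar>of_int (m - n)\<bar> + eps) * t n" for m
      unfolding t_def
    proof (rule perturbed_orbit_growth[where r = "\<lambda>m. f m (X m) - f m (Y m)" and d = d])
      show "X (m + 1) - Y (m + 1) = U (m + 1) m (X m - Y m) + (f m (X m) - f m (Y m))" for m
        by (simp add: X(2)[of m] Y(2)[of m] blinfun.diff_right)
    qed (use lip d_growth less_imp_le[OF d(1)] in auto)
    \<comment> \<open>\<open>W n\<close> is exchanged for \<open>W m\<close>, at the cost of one
      \<open>eps\<close> in the rate, so that \<open>d m\<close> can absorb it. The resulting rate
      \<open>\<alpha> * (rho + eps) + eps\<close> is \<open>lam - \<kappa>\<close> by the choice of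
      \<kappa>.\<close>
    have growth': "t m powr \<alpha> \<le> W m * exp ((lam - \<kappa>) * \<bar>of_int (m - n)\<bar> + eps) * t n powr \<alpha>" for m
    proof -
      let ?k = "\<bar>real_of_int (m - n)\<bar>"
      have "t m powr \<alpha> \<le> (W n * exp ((rho + eps) * ?k + eps) * t n) powr \<alpha>"
        using growth \<alpha> by (intro powr_mono2) (auto simp: t_def)
      also have "\<dots> = W n powr \<alpha> * exp (((rho + eps) * ?k + eps) * \<alpha>) * t n powr \<alpha>"
        using W_nonneg by (simp add: powr_mult t_def exp_powr_real)
      also have "\<dots> \<le> (W m * exp (eps * ?k)) * exp (((rho + eps) * ?k) * \<alpha> + eps) * t n powr \<alpha>"
      proof (intro mult_right_mono mult_mono)
        have "W n powr \<alpha> \<le> W n powr 1" using W_ge_1 \<alpha> by (intro powr_mono) auto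
        also have "\<dots> = W n" using W_nonneg by simp
        also have "\<dots> \<le> W m * exp (eps * ?k)" using W_slow[of n m] by (simp add: abs_minus_commute)
        finally show "W n powr \<alpha> \<le> W m * exp (eps * ?k)" .
        have "eps * \<alpha> \<le> eps" using \<alpha> eps_pos by simp
        then show "exp (((rho + eps) * ?k + eps) * \<alpha>) \<le> exp (((rho + eps) * ?k) * \<alpha> + eps)"
          by (simp add: algebra_simps)
      qed (use W_nonneg in auto)
      also have "\<dots> = W m * exp ((lam - \<kappa>) * ?k + eps) * t n powr \<alpha>"
        unfolding \<kappa>(2) by (simp add: algebra_simps flip: exp_add)
      finally show ?thesis .
    qed
    \<comment> \<open>The 5 counts two terms from the interpolated difference of \<open>f\<close>,
      two from that of \<open>g\<close>, and one from the deviation of \<open>H\<close> from the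
      identity inside \<open>g\<close>.\<close>
    have pbound: "norm (p m) \<le> 5 * W m * d m powr \<alpha> * (t m powr \<alpha> + E * exp (eps * \<bar>of_int m\<bar>))" for m
    proof -
      let ?e = "E * exp (eps * \<bar>of_int m\<bar>)"
      have interp: "u \<le> 2 * W m * d m powr \<alpha> * t m powr \<alpha>" if "0 \<le> u" "u \<le> 2 * W m" "u \<le> d m * t m" for u
        using le_interpolation[OF that \<alpha>] W_ge_1[of m] d(1)[of m] by (simp add: powr_mult t_def)
      have F: "norm (f m (X m) - f m (Y m)) \<le> 2 * W m * d m powr \<alpha> * t m powr \<alpha>"
        using norm_triangle_ineq4[of "f m (X m)" "f m (Y m)"] bdd(1)[of m "X m"] bdd(1)[of m "Y m"] lip(1)[of m "X m" "Y m"]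
        by (intro interp) (auto simp: t_def)
      define s where "s = t m powr \<alpha> + ?e"
      have s0: "0 \<le> s" using E0 by (simp add: s_def)
      have "norm (H m (X m) - H m (Y m)) = norm ((X m - Y m) + y m)" by (simp add: y_def)
      also have "\<dots> \<le> t m + s"
        using norm_triangle_ineq[of "X m - Y m" "y m"] Suc[of m "X m" "Y m"] by (simp add: t_def y_def s_def E_def)
      finally have "d m * norm (H m (X m) - H m (Y m)) \<le> d m * (t m + s)"
        using d(1)[of m] by (intro mult_left_mono) auto
      with lip(2)[of m "H m (X m)" "H m (Y m)"]
      have G1: "norm (g m (H m (X m)) - g m (H m (Y m))) \<le> d m * t m + d m * s" by (simp add: distrib_left)
      have G2: "norm (g m (H m (X m)) - g m (H m (Y m))) \<le> 2 * W m"
        using norm_triangle_ineq4[of "g m (H m (X m))" "g m (H m (Y m))"] bdd(2)[of m "H m (X m)"] bdd(2)[of m "H m (Y m)"]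
        by linarith
      \<comment> \<open>Only the part \<open>d m * t m\<close> of the Lipschitz bound for
        \<open>g\<close> is interpolated with the sup bound; the deviation \<open>d m * s\<close>
        stays additive. Whichever argument attains the minimum, \<open>G1\<close> or
        \<open>G2\<close> gives the estimate.\<close>
      have "min (2 * W m) (d m * t m) \<le> 2 * W m * d m powr \<alpha> * t m powr \<alpha>"
        using W_nonneg[of m] d(1)[of m] by (intro interp) (auto simp: t_def)
      moreover have "0 \<le> d m * s" using s0 d(1)[of m] by simp
      ultimately have G: "norm (g m (H m (X m)) - g m (H m (Y m))) \<le> 2 * W m * d m powr \<alpha> * t m powr \<alpha> + d m * s"
        using G1 G2 by linarith
      have "d m powr 1 \<le> d m powr \<alpha>" using d(1)[of m] d(2)[of m] \<alpha> by (intro powr_mono') auto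
      then have "d m \<le> d m powr \<alpha>" using d(1)[of m] by simp
      also have "\<dots> \<le> W m * d m powr \<alpha>" using mult_right_mono[OF W_ge_1[of m], of "d m powr \<alpha>"] by simp
      finally have ds: "d m * s \<le> W m * d m powr \<alpha> * s" using s0 by (intro mult_right_mono)
      have "W m * d m powr \<alpha> * t m powr \<alpha> \<le> W m * d m powr \<alpha> * s"
        using W_nonneg[of m] E0 by (intro mult_left_mono) (auto simp: s_def)
      moreover have "norm (p m) \<le> norm (g m (H m (X m)) - g m (H m (Y m))) + norm (f m (X m) - f m (Y m))"
        unfolding p_def by (rule norm_triangle_ineq4)
      ultimately have "norm (p m) \<le> 5 * (W m * d m powr \<alpha> * s)" using F G ds by linarith
      then show ?thesis by (simp add: s_def mult_ac)
    qed
    \<comment> \<open>The factor is chosen to leave \<open>1 / 2\<close> after multiplication by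
      \<open>2 / (1 - exp (- \<kappa>))\<close>. This halves \<open>E\<close>; the halved Hoelder
      term is rounded up to coefficient 1 again.\<close>
    define Q where "Q = (1 - exp (- \<kappa>)) / 4 * (t n powr \<alpha> + E * exp (eps * \<bar>of_int n\<bar>))"
    have "norm (y n) \<le> 2 / (1 - exp (- \<kappa>)) * Q"
    proof (rule trichotomy_estimate[OF yrec _ _ _ \<kappa>(1)])
      show "norm (y m) \<le> (2 * C) * exp (eps * \<bar>of_int m\<bar>)" for m
        using norm_triangle_ineq4[of "H m (X m) - X m" "H m (Y m) - Y m"] tame[of m "X m"] tame[of m "Y m"]
        by (simp add: y_def)
      show "y n = Ps n (y n) + Pu n (y n)"
      proof -
        have lin: "Ps n (a - b) + Pu n (a - b) = (Ps n a + Pu n a) - (Ps n b + Pu n b)" for a b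
          by (simp add: blinfun.diff_right)
        show ?thesis
          unfolding y_def lin[of "H n (X n) - X n"] split[symmetric] ..
      qed
      fix m
      let ?k = "\<bar>real_of_int (m - n)\<bar>"
      have "exp (eps * \<bar>of_int m\<bar>) \<le> exp (eps * \<bar>of_int n\<bar>) * exp (eps * ?k)"
        using eps_pos by (simp flip: exp_add distrib_left)
      also have "\<dots> \<le> exp (eps * \<bar>of_int n\<bar>) * exp ((lam - \<kappa>) * ?k + eps)"
      proof -
        have "eps \<le> lam - \<kappa>" using \<kappa>(2) \<alpha> rho_pos eps_pos by simp
        then have "eps * ?k \<le> (lam - \<kappa>) * ?k" by (intro mult_right_mono) auto
        then show ?thesis using eps_pos by (intro mult_left_mono) auto
      qed
      finally have "E * exp (eps * \<bar>of_int m\<bar>) \<le> E * (exp (eps * \<bar>of_int n\<bar>) * exp ((lam - \<kappa>) * ?k + eps))"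
        using E0 by (intro mult_left_mono)
      also have "\<dots> \<le> W m * (E * (exp (eps * \<bar>of_int n\<bar>) * exp ((lam - \<kappa>) * ?k + eps)))"
        using W_ge_1[of m] E0 mult_right_mono[OF W_ge_1[of m], of "E * (exp (eps * \<bar>of_int n\<bar>) * exp ((lam - \<kappa>) * ?k + eps))"] by simp
      finally have "t m powr \<alpha> + E * exp (eps * \<bar>of_int m\<bar>)
         \<le> W m * exp ((lam - \<kappa>) * ?k + eps) * (t n powr \<alpha> + E * exp (eps * \<bar>of_int n\<bar>))"
        using growth'[of m] by (simp add: algebra_simps)
      then have "5 * W m * d m powr \<alpha> * (t m powr \<alpha> + E * exp (eps * \<bar>of_int m\<bar>))
         \<le> 5 * W m * d m powr \<alpha> * (W m * exp ((lam - \<kappa>) * ?k + eps) * (t n powr \<alpha> + E * exp (eps * \<bar>of_int n\<bar>)))"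
        using W_nonneg[of m] by (intro mult_left_mono) auto
      with pbound[of m] have "norm (p m) \<le> 5 * W m * d m powr \<alpha> * (W m * exp ((lam - \<kappa>) * ?k + eps) * (t n powr \<alpha> + E * exp (eps * \<bar>of_int n\<bar>)))"
        by linarith
      then have "exp (lam + eps) * W m * norm (p m) \<le> exp (lam + eps) * W m * \<dots>"
        using W_nonneg[of m] by (intro mult_left_mono) auto
      \<comment> \<open>The three powers of \<open>W m\<close> come from the bound on
        \<open>p\<close>, from the exchange in \<open>growth'\<close>, and from the weight required
        by \<open>trichotomy_estimate\<close>.\<close>
      also have "\<dots> = (5 * exp (lam + 2 * eps) * W m ^ 3 * d m powr \<alpha>) * (exp ((lam - \<kappa>) * ?k) * (t n powr \<alpha> + E * exp (eps * \<bar>of_int n\<bar>)))"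
      proof -
        have "exp (lam + 2 * eps) = exp (lam + eps) * exp eps" by (simp flip: exp_add)
        then show ?thesis by (simp only: exp_add[of "(lam - \<kappa>) * ?k"]) (simp add: power3_eq_cube mult_ac)
      qed
      also have "\<dots> \<le> (1 - exp (- \<kappa>)) / 4 * (exp ((lam - \<kappa>) * ?k) * (t n powr \<alpha> + E * exp (eps * \<bar>of_int n\<bar>)))"
        using E0 by (intro mult_right_mono d_small) auto
      finally show "exp (lam + eps) * W m * norm (p m) \<le> Q * exp ((lam - \<kappa>) * ?k)"
        by (simp add: Q_def mult_ac)
    qed
    also have "\<dots> = (t n powr \<alpha> + E * exp (eps * \<bar>of_int n\<bar>)) / 2"
      using \<kappa>(1) by (simp add: Q_def)
    also have "\<dots> \<le> t n powr \<alpha> + E / 2 * exp (eps * \<bar>of_int n\<bar>)"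
      by simp
    finally show ?case by (simp add: E_def y_def X Y t0 mult_ac)
  qed
  have "(\<lambda>k. norm (x - z) powr \<alpha> + 2 * C * (1 / 2) ^ k * exp (eps * \<bar>of_int n\<bar>))
     \<longlonglongrightarrow> norm (x - z) powr \<alpha> + 2 * C * 0 * exp (eps * \<bar>of_int n\<bar>)"
    by (intro tendsto_intros LIMSEQ_realpow_zero) auto
  then show ?thesis
    using approx by (intro LIMSEQ_le_const) (auto simp: power_one_over)
qed

end

section \<open>Tempered random variables\<close>

lemma int_tendsto_0_iff:
  fixes F :: "int \<Rightarrow> real"
  shows "(F \<longlongrightarrow> 0) at_top \<and> (F \<longlongrightarrow> 0) at_bot \<longleftrightarrow> (\<forall>e>0. \<exists>N. \<forall>n. N \<le> \<bar>n\<bar> \<longrightarrow> \<bar>F n\<bar> < e)"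
proof safe
  fix e :: real assume e: "0 < e" and "(F \<longlongrightarrow> 0) at_top" "(F \<longlongrightarrow> 0) at_bot"
  then have "\<forall>\<^sub>F n in at_top. \<bar>F n\<bar> < e" "\<forall>\<^sub>F n in at_bot. \<bar>F n\<bar> < e"
    by (auto dest!: tendstoD[where e = e] simp: dist_real_def)
  then obtain N1 N2 where "\<And>n. N1 \<le> n \<Longrightarrow> \<bar>F n\<bar> < e" "\<And>n. n \<le> N2 \<Longrightarrow> \<bar>F n\<bar> < e"
    unfolding eventually_at_top_linorder eventually_at_bot_linorder by blast
  then show "\<exists>N. \<forall>n. N \<le> \<bar>n\<bar> \<longrightarrow> \<bar>F n\<bar> < e"
    by (intro exI[of _ "max N1 (- N2)"]) (smt (verit))
next
  assume *: "\<forall>e>0. \<exists>N. \<forall>n. N \<le> \<bar>n\<bar> \<longrightarrow> \<bar>F n\<bar> < e"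
  show "(F \<longlongrightarrow> 0) at_top"
  proof (rule tendstoI)
    fix e :: real assume "0 < e"
    with * obtain N where "\<And>n. N \<le> \<bar>n\<bar> \<Longrightarrow> \<bar>F n\<bar> < e" by blast
    then show "\<forall>\<^sub>F n in at_top. dist (F n) 0 < e"
      unfolding eventually_at_top_linorder by (intro exI[of _ N]) auto
  qed
  show "(F \<longlongrightarrow> 0) at_bot"
  proof (rule tendstoI)
    fix e :: real assume "0 < e"
    with * obtain N where "\<And>n. N \<le> \<bar>n\<bar> \<Longrightarrow> \<bar>F n\<bar> < e" by blast
    then show "\<forall>\<^sub>F n in at_bot. dist (F n) 0 < e"
      unfolding eventually_at_bot_linorder by (intro exI[of _ "- N"]) auto
  qed
qed

lemma int_const_div_tendsto_0:
  fixes c :: real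
  shows "((\<lambda>n::int. c / of_int n) \<longlongrightarrow> 0) at_top \<and> ((\<lambda>n::int. c / of_int n) \<longlongrightarrow> 0) at_bot"
  unfolding int_tendsto_0_iff
proof (intro allI impI)
  fix e :: real assume e: "0 < e"
  define N where "N = \<lceil>\<bar>c\<bar> / e\<rceil> + 1"
  have "\<bar>c / of_int n\<bar> < e" if "N \<le> \<bar>n\<bar>" for n :: int
  proof -
    have "\<bar>c\<bar> / e < of_int N" unfolding N_def by linarith
    also have "\<dots> \<le> of_int \<bar>n\<bar>" using that by linarith
    finally have n: "\<bar>c\<bar> / e < \<bar>of_int n\<bar>" by simp
    have "0 \<le> \<bar>c\<bar> / e" using e by simp
    with n have "0 < \<bar>real_of_int n\<bar>" by linarith
    then show ?thesis using n e by (simp add: abs_divide divide_simps mult.commute)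
  qed
  then show "\<exists>N. \<forall>n. N \<le> \<bar>n\<bar> \<longrightarrow> \<bar>c / of_int n\<bar> < e" by blast
qed

text \<open>The rate controls all but a finite window of times, and the maximum over this window
  supplies the constant.\<close>

lemma subexponential_of_tendsto:
  fixes T :: "int \<Rightarrow> real"
  assumes "((\<lambda>n. ln (T n) / of_int n) \<longlongrightarrow> 0) at_top" "((\<lambda>n. ln (T n) / of_int n) \<longlongrightarrow> 0) at_bot"
    and pos: "\<And>n. 0 < T n" and "0 < \<delta>"
  obtains C where "\<And>n. T n \<le> C * exp (\<delta> * \<bar>of_int n\<bar>)"
proof -
  have "\<exists>N. \<forall>n. N \<le> \<bar>n\<bar> \<longrightarrow> \<bar>ln (T n) / of_int n\<bar> < \<delta>"
    using assms(1,2,4) int_tendsto_0_iff[of "\<lambda>n. ln (T n) / of_int n"] by blast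
  then obtain N where N: "\<And>n. N \<le> \<bar>n\<bar> \<Longrightarrow> \<bar>ln (T n) / of_int n\<bar> < \<delta>" by blast
  define I where "I = {- \<bar>N\<bar>..\<bar>N\<bar>}"
  define C where "C = Max (insert 1 (T ` I))"
  have fin: "finite (insert 1 (T ` I))" by (simp add: I_def)
  have C1: "1 \<le> C" unfolding C_def using fin by (intro Max_ge) auto
  have "T n \<le> C * exp (\<delta> * \<bar>of_int n\<bar>)" for n
  proof (cases "n \<in> I")
    case True
    then have "T n \<le> C" unfolding C_def using fin by (intro Max_ge) auto
    also have "\<dots> \<le> C * exp (\<delta> * \<bar>of_int n\<bar>)" using C1 \<open>0 < \<delta>\<close> by simp
    finally show ?thesis .
  next
    case False
    then have n: "N \<le> \<bar>n\<bar>" "n \<noteq> 0" unfolding I_def by auto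
    then have "\<bar>ln (T n)\<bar> < \<delta> * \<bar>of_int n\<bar>" using N[of n] by (simp add: abs_divide divide_simps)
    then have "T n \<le> exp (\<delta> * \<bar>of_int n\<bar>)" using pos[of n] by (smt (verit) exp_ln exp_le_cancel_iff)
    also have "\<dots> \<le> C * exp (\<delta> * \<bar>of_int n\<bar>)" using C1 by simp
    finally show ?thesis .
  qed
  then show ?thesis using that by blast
qed

text \<open>Growth at rate \<open>e / 2\<close> leaves the other half of \<open>e\<close> for
  \<open>ln C / n\<close>. With the preceding lemma, temperedness along an orbit of a function with
  values at least 1 amounts to subexponential growth.\<close>

lemma tendsto_of_subexponential:
  fixes T :: "int \<Rightarrow> real"
  assumes T: "\<And>n. 1 \<le> T n" and sub: "\<And>\<delta>. 0 < \<delta> \<Longrightarrow> \<exists>C. \<forall>n. T n \<le> C * exp (\<delta> * \<bar>of_int n\<bar>)"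
  shows "((\<lambda>n. ln (T n) / of_int n) \<longlongrightarrow> 0) at_top \<and> ((\<lambda>n. ln (T n) / of_int n) \<longlongrightarrow> 0) at_bot"
  unfolding int_tendsto_0_iff
proof (intro allI impI)
  fix e :: real assume e: "0 < e"
  obtain C where C: "\<And>n. T n \<le> C * exp (e / 2 * \<bar>of_int n\<bar>)" using sub[of "e / 2"] e by auto
  have C1: "1 \<le> C" using C[of 0] T[of 0] by simp
  have "0 < e / 2" using e by simp
  then obtain N where N: "\<And>n::int. N \<le> \<bar>n\<bar> \<Longrightarrow> \<bar>ln C / of_int n\<bar> < e / 2"
    using int_const_div_tendsto_0[of "ln C"] unfolding int_tendsto_0_iff by blast
  have "\<bar>ln (T n) / of_int n\<bar> < e" if "N \<le> \<bar>n\<bar>" for n :: int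
  proof (cases "n = 0")
    case False
    have "ln (T n) \<le> ln (C * exp (e / 2 * \<bar>of_int n\<bar>))"
      using C[of n] T[of n] C1 by (subst ln_le_cancel_iff) auto
    also have "\<dots> = ln C + e / 2 * \<bar>of_int n\<bar>" using C1 by (simp add: ln_mult)
    finally have "\<bar>ln (T n)\<bar> / \<bar>of_int n\<bar> \<le> \<bar>ln C\<bar> / \<bar>of_int n\<bar> + e / 2"
      using False T[of n] C1 by (simp add: divide_simps)
    also have "\<dots> < e" using N[OF that] unfolding abs_divide by linarith
    finally show ?thesis by (simp add: abs_divide)
  qed (use e in auto)
  then show "\<exists>N. \<forall>n. N \<le> \<bar>n\<bar> \<longrightarrow> \<bar>ln (T n) / of_int n\<bar> < e" by blast
qed

section \<open>Iterates of the base and tempered functions along orbits\<close>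

context ergodic_system
begin

abbreviation iter :: "int \<Rightarrow> 'w \<Rightarrow> 'w" where "iter \<equiv> base_iter M \<sigma>"

lemma \<sigma>_in_space: "\<omega> \<in> space M \<Longrightarrow> \<sigma> \<omega> \<in> space M"
  using base_bij by (auto simp: bij_betw_def)

lemma base_inv_in_space: "\<omega> \<in> space M \<Longrightarrow> base_inv M \<sigma> \<omega> \<in> space M"
  unfolding base_inv_def using base_bij by (auto simp: bij_betw_def intro: inv_into_into)

lemma \<sigma>_base_inv: "\<omega> \<in> space M \<Longrightarrow> \<sigma> (base_inv M \<sigma> \<omega>) = \<omega>"
  unfolding base_inv_def by (rule bij_betw_inv_into_right[OF base_bij])

lemma base_inv_\<sigma>: "\<omega> \<in> space M \<Longrightarrow> base_inv M \<sigma> (\<sigma> \<omega>) = \<omega>"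
  unfolding base_inv_def by (rule bij_betw_inv_into_left[OF base_bij])

lemma base_inv_funpow_in_space: "\<omega> \<in> space M \<Longrightarrow> (base_inv M \<sigma> ^^ n) \<omega> \<in> space M"
  by (induction n) (auto intro: base_inv_in_space)

lemma iter_0 [simp]: "iter 0 \<omega> = \<omega>"
  by (simp add: base_iter_def)

lemma iter_in_space: "\<omega> \<in> space M \<Longrightarrow> iter n \<omega> \<in> space M"
proof -
  assume w: "\<omega> \<in> space M"
  have "(\<sigma> ^^ k) \<omega> \<in> space M" for k using w by (induction k) (auto intro: \<sigma>_in_space)
  with base_inv_funpow_in_space[OF w] show ?thesis by (simp add: base_iter_def)
qed

lemma iter_plus_1:
  assumes "\<omega> \<in> space M"
  shows "iter (n + 1) \<omega> = \<sigma> (iter n \<omega>)"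
proof (cases "0 \<le> n")
  case True
  then have "nat (n + 1) = Suc (nat n)" by simp
  then show ?thesis using True by (simp add: base_iter_def)
next
  case False
  define k where "k = nat (- n - 1)"
  have n: "n = - int (Suc k)" using False by (simp add: k_def)
  have "nat (- n) = Suc k" using n by simp
  then have "iter n \<omega> = base_inv M \<sigma> ((base_inv M \<sigma> ^^ k) \<omega>)" using False by (simp add: base_iter_def)
  then have "\<sigma> (iter n \<omega>) = (base_inv M \<sigma> ^^ k) \<omega>"
    using assms by (simp add: \<sigma>_base_inv base_inv_funpow_in_space)
  also have "\<dots> = iter (n + 1) \<omega>"
  proof (cases "k = 0")
    case False
    then have "nat (- (n + 1)) = k" "\<not> 0 \<le> n + 1" using n by auto
    then show ?thesis by (simp only: base_iter_def if_False)
  qed (simp add: n)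
  finally show ?thesis ..
qed

lemma iter_minus_1:
  assumes "\<omega> \<in> space M"
  shows "iter (n - 1) \<omega> = base_inv M \<sigma> (iter n \<omega>)"
  using iter_plus_1[OF assms, of "n - 1"] base_inv_\<sigma>[OF iter_in_space[OF assms, of "n - 1"]] by simp

lemma iter_iter:
  assumes "\<omega> \<in> space M"
  shows "iter m (iter n \<omega>) = iter (m + n) \<omega>"
proof (induction m rule: int_induct[where k = 0])
  case (step1 i)
  then show ?case
    using iter_plus_1[OF iter_in_space[OF assms], of i n] iter_plus_1[OF assms, of "i + n"] by (simp add: add_ac)
next
  case (step2 i)
  then show ?case
    using iter_minus_1[OF iter_in_space[OF assms], of i n] iter_minus_1[OF assms, of "i + n"] by (simp add: algebra_simps)
qed simp

lemma measure_preserving_funpow: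
  assumes h: "h \<in> measurable M M" "distr M M h = M"
  shows "h ^^ n \<in> measurable M M \<and> distr M M (h ^^ n) = M"
proof (induction n)
  case 0
  then show ?case by (simp add: id_def distr_id)
next
  case (Suc n)
  then have "h ^^ Suc n \<in> measurable M M" using h by (auto intro: measurable_comp)
  moreover have "distr M M (h ^^ Suc n) = distr (distr M M (h ^^ n)) M h"
    using distr_distr[OF h(1) conjunct1[OF Suc]] by simp
  ultimately show ?case using Suc h by (simp del: funpow.simps)
qed

lemma base_inv_preserving: "distr M M (base_inv M \<sigma>) = M"
proof -
  have "distr M M (base_inv M \<sigma>) = distr (distr M M \<sigma>) M (base_inv M \<sigma>)" by (simp add: base_preserving)
  also have "\<dots> = distr M M (base_inv M \<sigma> \<circ> \<sigma>)"
    by (rule distr_distr[OF base_inv_measurable base_measurable])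
  also have "\<dots> = distr M M (\<lambda>x. x)" by (rule distr_cong) (auto simp: base_inv_\<sigma>)
  finally show ?thesis by (simp add: distr_id)
qed

lemma iter_measure_preserving: "iter n \<in> measurable M M \<and> distr M M (iter n) = M"
  using measure_preserving_funpow[OF base_measurable base_preserving, of "nat n"]
    measure_preserving_funpow[OF base_inv_measurable base_inv_preserving, of "nat (- n)"]
  by (simp add: base_iter_def)

text \<open>Every iterate, forward or backward, preserves the measure, and countably many null sets
  have a null union. Almost sure hypotheses thus hold along whole orbits.\<close>

lemma AE_iter:
  assumes "AE \<omega> in M. Q \<omega>"
  shows "AE \<omega> in M. \<forall>n. Q (iter n \<omega>)"
  unfolding AE_all_countable
proof
  fix n
  have "AE \<omega> in distr M M (iter n). Q \<omega>"
    using assms by (subst conjunct2[OF iter_measure_preserving])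
  then show "AE \<omega> in M. Q (iter n \<omega>)"
    by (rule AE_distrD[OF conjunct1[OF iter_measure_preserving]])
qed

lemma tempered_imp_subexponential:
  assumes "tempered M \<sigma> T"
  shows "AE \<omega> in M. \<forall>\<delta>>0. \<exists>C. \<forall>n. T (iter n \<omega>) \<le> C * exp (\<delta> * \<bar>of_int n\<bar>)"
proof -
  have "AE \<omega> in M. ((\<lambda>n::int. ln (T (iter n \<omega>)) / of_int n) \<longlongrightarrow> 0) at_top \<and>
        ((\<lambda>n::int. ln (T (iter n \<omega>)) / of_int n) \<longlongrightarrow> 0) at_bot"
    using assms by (simp add: tempered_def)
  with AE_space show ?thesis
  proof eventually_elim
    case (elim \<omega>)
    have pos: "0 < T (iter n \<omega>)" for n using assms iter_in_space[OF elim(1)] by (auto simp: tempered_def)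
    show ?case
    proof (intro allI impI)
      fix \<delta> :: real assume "0 < \<delta>"
      from subexponential_of_tendsto[OF conjunct1[OF elim(2)] conjunct2[OF elim(2)] pos this]
      show "\<exists>C. \<forall>n. T (iter n \<omega>) \<le> C * exp (\<delta> * \<bar>of_int n\<bar>)" by blast
    qed
  qed
qed

lemma tempered_mult:
  assumes "tempered M \<sigma> V" "tempered M \<sigma> V'"
  shows "tempered M \<sigma> (\<lambda>\<omega>. V \<omega> * V' \<omega>)"
proof -
  let ?l = "\<lambda>V \<omega> n. ln (V (iter n \<omega>)) / real_of_int n"
  have "AE \<omega> in M. (?l V \<omega> \<longlongrightarrow> 0) at_top \<and> (?l V \<omega> \<longlongrightarrow> 0) at_bot"
    "AE \<omega> in M. (?l V' \<omega> \<longlongrightarrow> 0) at_top \<and> (?l V' \<omega> \<longlongrightarrow> 0) at_bot"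
    using assms by (auto simp: tempered_def)
  with AE_space have "AE \<omega> in M. (?l (\<lambda>\<omega>. V \<omega> * V' \<omega>) \<omega> \<longlongrightarrow> 0) at_top \<and> (?l (\<lambda>\<omega>. V \<omega> * V' \<omega>) \<omega> \<longlongrightarrow> 0) at_bot"
  proof eventually_elim
    case (elim \<omega>)
    have "0 < V (iter n \<omega>)" "0 < V' (iter n \<omega>)" for n
      using assms iter_in_space[OF elim(1), of n] unfolding tempered_def by blast+
    then have "V (iter n \<omega>) \<noteq> 0" "V' (iter n \<omega>) \<noteq> 0" for n
      by (metis less_irrefl)+
    then have "?l (\<lambda>\<omega>. V \<omega> * V' \<omega>) \<omega> = (\<lambda>n. ?l V \<omega> n + ?l V' \<omega> n)"
      by (auto simp: ln_mult add_divide_distrib)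
    then show ?case using elim(2,3) by (auto intro: tendsto_add_zero)
  qed
  then show ?thesis using assms by (auto simp: tempered_def)
qed

text \<open>The function \<open>d\<close> of the theorem has this form; its logarithm is an affine
  function of \<open>ln W\<close>.\<close>

lemma tempered_powr:
  assumes "tempered M \<sigma> W" "0 < \<mu>"
  shows "tempered M \<sigma> (\<lambda>\<omega>. (\<mu> / W \<omega> ^ k) powr r)"
proof -
  let ?l = "\<lambda>V \<omega> n. ln (V (iter n \<omega>)) / real_of_int n"
  let ?d = "\<lambda>\<omega>. (\<mu> / W \<omega> ^ k) powr r"
  have pos: "0 < W \<omega>" if "\<omega> \<in> space M" for \<omega> using assms that by (auto simp: tempered_def)
  have "AE \<omega> in M. (?l W \<omega> \<longlongrightarrow> 0) at_top \<and> (?l W \<omega> \<longlongrightarrow> 0) at_bot"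
    using assms by (auto simp: tempered_def)
  with AE_space have "AE \<omega> in M. (?l ?d \<omega> \<longlongrightarrow> 0) at_top \<and> (?l ?d \<omega> \<longlongrightarrow> 0) at_bot"
  proof eventually_elim
    case (elim \<omega>)
    have "0 < W (iter n \<omega>)" "W (iter n \<omega>) \<noteq> 0" for n using pos[OF iter_in_space[OF elim(1), of n]] by auto
    then have "ln (?d (iter n \<omega>)) = r * ln \<mu> - r * real k * ln (W (iter n \<omega>))" for n
      using assms(2) by (simp add: ln_powr ln_div ln_realpow right_diff_distrib)
    then have eq: "?l ?d \<omega> = (\<lambda>n. r * ln \<mu> / of_int n - r * real k * ?l W \<omega> n)"
      by (simp add: diff_divide_distrib)
    have "(?l ?d \<omega> \<longlongrightarrow> 0 - r * real k * 0) at_top" unfolding eq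
      using elim(2) int_const_div_tendsto_0[of "r * ln \<mu>"] by (intro tendsto_diff tendsto_mult_left) auto
    moreover have "(?l ?d \<omega> \<longlongrightarrow> 0 - r * real k * 0) at_bot" unfolding eq
      using elim(2) int_const_div_tendsto_0[of "r * ln \<mu>"] by (intro tendsto_diff tendsto_mult_left) auto
    ultimately show ?case by simp
  qed
  moreover have "0 < ?d \<omega>" if "\<omega> \<in> space M" for \<omega> using pos[OF that] assms(2) by simp
  ultimately show ?thesis using assms by (auto simp: tempered_def)
qed

text \<open>The supremum of \<open>V\<close> over the orbit, discounted by
  \<open>exp (- eps * |n|)\<close>, varies slowly because moving the base point only shifts the
  index. Any subexponential bound for \<open>V\<close> at a rate below \<open>eps\<close> passes to
  it, so it remains tempered.\<close>

lemma ex_slowly_varying_majorant: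
  assumes V: "tempered M \<sigma> V" and eps: "0 < eps"
  obtains W where "tempered M \<sigma> W" "\<And>\<omega>. 1 \<le> W \<omega>" "AE \<omega> in M. V \<omega> \<le> W \<omega>"
    "AE \<omega> in M. \<forall>n m. W (iter n \<omega>) \<le> W (iter m \<omega>) * exp (eps * \<bar>of_int (n - m)\<bar>)"
proof -
  define S where "S \<omega> = (SUP n. ereal (V (iter n \<omega>) * exp (- eps * \<bar>of_int n\<bar>)))" for \<omega>
  \<comment> \<open>Off the almost sure set where \<open>S\<close> is finite, \<open>real_of_ereal\<close> returns the junk value \<open>0\<close>.\<close>
  define W where "W \<omega> = max 1 (real_of_ereal (S \<omega>))" for \<omega>
  have Vm: "V \<in> borel_measurable M" and Vpos: "\<And>\<omega>. \<omega> \<in> space M \<Longrightarrow> 0 < V \<omega>"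
    using V by (auto simp: tempered_def)
  have "(\<lambda>\<omega>. V (iter n \<omega>)) \<in> borel_measurable M" for n
    by (rule measurable_compose[OF conjunct1[OF iter_measure_preserving] Vm])
  then have Wm: "W \<in> borel_measurable M" unfolding W_def S_def by measurable
  have W1: "1 \<le> W \<omega>" for \<omega> by (simp add: W_def)
  have W0: "0 \<le> W \<omega>" for \<omega> using W1[of \<omega>] by linarith
  define good where "good \<omega> \<longleftrightarrow> \<omega> \<in> space M \<and> (\<forall>\<delta>>0. \<exists>C. \<forall>n. V (iter n \<omega>) \<le> C * exp (\<delta> * \<bar>of_int n\<bar>))" for \<omega>
  have AE_good: "AE \<omega> in M. good \<omega>"
    unfolding good_def using tempered_imp_subexponential[OF V] by (auto intro: AE_conjI)
  \<comment> \<open>With \<delta> = \<open>eps\<close> this makes the supremum finite; smaller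
    \<delta> will give its temperedness.\<close>
  have shift: "V (iter (n + m) \<omega>) * exp (- eps * \<bar>of_int n\<bar>) \<le> C * exp (\<delta> * \<bar>of_int m\<bar>)"
    if "\<And>n. V (iter n \<omega>) \<le> C * exp (\<delta> * \<bar>of_int n\<bar>)" "\<omega> \<in> space M" "0 < \<delta>" "\<delta> \<le> eps" for \<omega> C \<delta> n m
  proof -
    have "0 < C * exp (\<delta> * \<bar>of_int 0\<bar>)"
      using less_le_trans[OF Vpos[OF iter_in_space[OF that(2)]] that(1)] .
    then have C0: "0 < C" by simp
    have "V (iter (n + m) \<omega>) * exp (- eps * \<bar>of_int n\<bar>) \<le> C * exp (\<delta> * \<bar>of_int (n + m)\<bar>) * exp (- eps * \<bar>of_int n\<bar>)"
      by (intro mult_right_mono that(1)) auto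
    also have "\<dots> = C * exp (\<delta> * \<bar>of_int (n + m)\<bar> - eps * \<bar>of_int n\<bar>)"
      by (simp flip: exp_add)
    also have "\<dots> \<le> C * exp (\<delta> * \<bar>of_int m\<bar>)"
    proof -
      have "\<delta> * \<bar>real_of_int (n + m)\<bar> \<le> \<delta> * (\<bar>of_int n\<bar> + \<bar>of_int m\<bar>)"
        using that(3) by (intro mult_left_mono) auto
      moreover have "\<delta> * \<bar>real_of_int n\<bar> \<le> eps * \<bar>of_int n\<bar>"
        using that(4) by (intro mult_right_mono) auto
      ultimately show ?thesis using C0 by (simp add: distrib_left)
    qed
    finally show ?thesis .
  qed
  have upper: "W (iter m \<omega>) \<le> B"
    if "good \<omega>" "1 \<le> B" "\<And>n. V (iter (n + m) \<omega>) * exp (- eps * \<bar>of_int n\<bar>) \<le> B" for \<omega> m B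
  proof -
    have w: "\<omega> \<in> space M" using that(1) by (simp add: good_def)
    have "S (iter m \<omega>) \<le> ereal B" unfolding S_def
      by (rule SUP_least) (use that(3) in \<open>simp add: iter_iter[OF w]\<close>)
    then have "real_of_ereal (S (iter m \<omega>)) \<le> B"
      using that(2) by (cases "S (iter m \<omega>)") auto
    then show ?thesis using that(2) by (simp add: W_def)
  qed
  \<comment> \<open>Finiteness of \<open>S\<close> is essential here, since only then does
    \<open>real_of_ereal\<close> preserve the lower bound by each term.\<close>
  have lower: "V (iter (n + m) \<omega>) * exp (- eps * \<bar>of_int n\<bar>) \<le> W (iter m \<omega>)" if good: "good \<omega>" for \<omega> n m
  proof -
    have w: "\<omega> \<in> space M" using good by (simp add: good_def)
    obtain C where C: "\<And>n. V (iter n \<omega>) \<le> C * exp (eps * \<bar>of_int n\<bar>)"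
      using good eps unfolding good_def by blast
    have "S (iter m \<omega>) \<le> ereal (C * exp (eps * \<bar>of_int m\<bar>))" unfolding S_def
      by (rule SUP_least) (use shift[OF C w eps] in \<open>simp add: iter_iter[OF w]\<close>)
    moreover have le: "ereal (V (iter (n + m) \<omega>) * exp (- eps * \<bar>of_int n\<bar>)) \<le> S (iter m \<omega>)" unfolding S_def
      by (rule SUP_upper2[of n]) (auto simp: iter_iter[OF w])
    ultimately have "V (iter (n + m) \<omega>) * exp (- eps * \<bar>of_int n\<bar>) \<le> real_of_ereal (S (iter m \<omega>))"
      by (cases "S (iter m \<omega>)") auto
    then show ?thesis by (simp add: W_def)
  qed
  have "AE \<omega> in M. V \<omega> \<le> W \<omega>"
    using AE_good by eventually_elim (use lower[of _ 0 0] in auto)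
  moreover have "AE \<omega> in M. \<forall>n m. W (iter n \<omega>) \<le> W (iter m \<omega>) * exp (eps * \<bar>of_int (n - m)\<bar>)"
    using AE_good
  proof eventually_elim
    case (elim \<omega>)
    show ?case
    proof (intro allI upper[OF elim])
      fix n m
      have "1 * 1 \<le> W (iter m \<omega>) * exp (eps * \<bar>of_int (n - m)\<bar>)"
        using W1 W0 eps by (intro mult_mono) auto
      then show "1 \<le> W (iter m \<omega>) * exp (eps * \<bar>of_int (n - m)\<bar>)" by simp
      fix k
      have "V (iter (k + n) \<omega>) * exp (- eps * \<bar>of_int k\<bar>)
         = V (iter (k + n - m + m) \<omega>) * exp (- eps * \<bar>of_int (k + n - m)\<bar>) * exp (eps * \<bar>of_int (k + n - m)\<bar> - eps * \<bar>of_int k\<bar>)"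
        by (simp flip: exp_add)
      also have "\<dots> \<le> W (iter m \<omega>) * exp (eps * \<bar>of_int (k + n - m)\<bar> - eps * \<bar>of_int k\<bar>)"
        by (intro mult_right_mono lower[OF elim]) auto
      also have "\<dots> \<le> W (iter m \<omega>) * exp (eps * \<bar>of_int (n - m)\<bar>)"
      proof -
        have "eps * (\<bar>real_of_int (k + n - m)\<bar> - \<bar>of_int k\<bar>) \<le> eps * \<bar>of_int (n - m)\<bar>"
          using eps by (intro mult_left_mono) auto
        then have "exp (eps * \<bar>of_int (k + n - m)\<bar> - eps * \<bar>of_int k\<bar>) \<le> exp (eps * \<bar>of_int (n - m)\<bar>)"
          unfolding exp_le_cancel_iff by (simp add: right_diff_distrib)
        then show ?thesis using W0 by (intro mult_left_mono) auto
      qed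
      finally show "V (iter (k + n) \<omega>) * exp (- eps * \<bar>of_int k\<bar>) \<le> W (iter m \<omega>) * exp (eps * \<bar>of_int (n - m)\<bar>)" .
    qed
  qed
  moreover have "tempered M \<sigma> W"
    unfolding tempered_def
  proof (intro conjI ballI)
    show "W \<in> borel_measurable M" by (rule Wm)
    show "0 < W \<omega>" for \<omega> using W1[of \<omega>] by simp
    show "AE \<omega> in M. ((\<lambda>n. ln (W (iter n \<omega>)) / of_int n) \<longlongrightarrow> 0) at_top \<and> ((\<lambda>n. ln (W (iter n \<omega>)) / of_int n) \<longlongrightarrow> 0) at_bot"
      using AE_good
    proof eventually_elim
      case (elim \<omega>)
      have w: "\<omega> \<in> space M" using elim by (simp add: good_def)
      show ?case
      proof (rule tendsto_of_subexponential[OF W1])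
        fix \<delta> :: real assume \<delta>: "0 < \<delta>"
        \<comment> \<open>The discount \<open>eps\<close> dominates only growth rates up to
          \<open>eps\<close>, so larger \<delta> are cut off.\<close>
        define \<delta>' where "\<delta>' = min \<delta> eps"
        have \<delta>': "0 < \<delta>'" "\<delta>' \<le> eps" "\<delta>' \<le> \<delta>" using \<delta> eps by (auto simp: \<delta>'_def)
        obtain C where C: "\<And>n. V (iter n \<omega>) \<le> C * exp (\<delta>' * \<bar>of_int n\<bar>)"
          using elim \<delta>'(1) unfolding good_def by blast
        have "W (iter m \<omega>) \<le> max 1 C * exp (\<delta> * \<bar>of_int m\<bar>)" for m
        proof (rule upper[OF elim])
          have "1 * 1 \<le> max 1 C * exp (\<delta> * \<bar>of_int m\<bar>)" using \<delta> by (intro mult_mono) auto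
          then show "1 \<le> max 1 C * exp (\<delta> * \<bar>of_int m\<bar>)" by simp
          fix n
          have "V (iter (n + m) \<omega>) * exp (- eps * \<bar>of_int n\<bar>) \<le> C * exp (\<delta>' * \<bar>of_int m\<bar>)"
            by (rule shift[OF C w \<delta>'(1,2)])
          also have "\<dots> \<le> max 1 C * exp (\<delta> * \<bar>of_int m\<bar>)"
            using \<delta>'(3) by (intro mult_mono) (auto intro: mult_right_mono)
          finally show "V (iter (n + m) \<omega>) * exp (- eps * \<bar>of_int n\<bar>) \<le> max 1 C * exp (\<delta> * \<bar>of_int m\<bar>)" .
        qed
        then show "\<exists>C. \<forall>n. W (iter n \<omega>) \<le> C * exp (\<delta> * \<bar>of_int n\<bar>)" by blast
      qed
    qed
  qed
  ultimately show ?thesis using that W1 by blast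
qed

end

section \<open>Regularity of the conjugacies\<close>

lemma blinfun_compose_assoc: "(X o\<^sub>L Y) o\<^sub>L Z = X o\<^sub>L (Y o\<^sub>L Z)"
  by (rule blinfun_eqI) simp

lemma blinfun_compose_id_left [simp]: "id_blinfun o\<^sub>L X = X"
  by (rule blinfun_eqI) simp

lemma blinfun_compose_id_right [simp]: "X o\<^sub>L id_blinfun = X"
  by (rule blinfun_eqI) simp

lemma op_inverse_of_op_inv: "op_invertible B \<Longrightarrow> op_inverse_of B (op_inv B)"
  unfolding op_inv_def
proof (rule theI')
  assume "op_invertible B"
  then obtain C where C: "op_inverse_of B C" by (auto simp: op_invertible_def)
  moreover have "C' = C" if "op_inverse_of B C'" for C'
    using that C unfolding op_inverse_of_def
    by (metis blinfun_compose_assoc blinfun_compose_id_left blinfun_compose_id_right)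
  ultimately show "\<exists>!C. op_inverse_of B C" by blast
qed

lemma op_inverse_cancel:
  assumes "op_invertible B" "B o\<^sub>L X = B o\<^sub>L Y"
  shows "X = Y"
  using op_inverse_of_op_inv[OF assms(1)] assms(2) unfolding op_inverse_of_def
  by (metis blinfun_compose_assoc blinfun_compose_id_left)

text \<open>Only a one-step recursion is given. Induction runs in both time directions: forward by
  composing with \<open>B i\<close>, backward by cancelling the invertible
  \<open>B (i - 1)\<close>.\<close>

lemma evolution_family:
  fixes U :: "int \<Rightarrow> int \<Rightarrow> 'a::real_normed_vector \<Rightarrow>\<^sub>L 'a"
  assumes refl: "\<And>n. U n n = id_blinfun" and step: "\<And>m n. U (m + 1) n = B m o\<^sub>L U m n"
    and inv: "\<And>m. op_invertible (B m)"
  shows evolution_family_trans: "U l m o\<^sub>L U m n = U l n"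
    and evolution_family_commute:
      "(\<And>m. B m o\<^sub>L Q m = Q (m + 1) o\<^sub>L B m) \<Longrightarrow> Q m o\<^sub>L U m n = U m n o\<^sub>L Q n"
proof -
  have pred: "B (i - 1) o\<^sub>L U (i - 1) n = U i n" for i n using step[of "i - 1" n] by simp
  show "U l m o\<^sub>L U m n = U l n"
  proof (induction l rule: int_induct[where k = m])
    case (step1 i)
    then show ?case by (simp add: step blinfun_compose_assoc)
  next
    case (step2 i)
    have "B (i - 1) o\<^sub>L (U (i - 1) m o\<^sub>L U m n) = B (i - 1) o\<^sub>L U (i - 1) n"
      using step2 by (simp add: pred flip: blinfun_compose_assoc)
    then show ?case by (rule op_inverse_cancel[OF inv])
  qed (simp add: refl)
  assume Q: "\<And>m. B m o\<^sub>L Q m = Q (m + 1) o\<^sub>L B m"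
  show "Q m o\<^sub>L U m n = U m n o\<^sub>L Q n"
  proof (induction m rule: int_induct[where k = n])
    case (step1 i)
    have "Q (i + 1) o\<^sub>L U (i + 1) n = (B i o\<^sub>L Q i) o\<^sub>L U i n"
      by (simp add: step Q blinfun_compose_assoc)
    also have "\<dots> = U (i + 1) n o\<^sub>L Q n" using step1 by (simp add: step blinfun_compose_assoc)
    finally show ?case .
  next
    case (step2 i)
    have "B (i - 1) o\<^sub>L (Q (i - 1) o\<^sub>L U (i - 1) n) = (B (i - 1) o\<^sub>L Q (i - 1)) o\<^sub>L U (i - 1) n"
      by (simp add: blinfun_compose_assoc)
    also have "\<dots> = Q i o\<^sub>L U i n" using Q[of "i - 1"] by (simp add: pred blinfun_compose_assoc)
    also have "\<dots> = B (i - 1) o\<^sub>L (U (i - 1) n o\<^sub>L Q n)"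
      using step2 by (simp add: pred flip: blinfun_compose_assoc)
    finally show ?case by (rule op_inverse_cancel[OF inv])
  qed (simp add: refl)
qed

text \<open>Solve first for the component \<open>y\<close> in the range of \<open>Q\<close>, then
  for the remaining one on the fiber over \<open>y\<close>. This turns the invertibility condition
  on admissible pairs into surjectivity on the whole space.\<close>

lemma surj_of_onto_fibers:
  assumes proj: "Q o\<^sub>L Q = Q" "Q' o\<^sub>L Q' = Q'"
    and onto: "range (blinfun_apply Q') \<subseteq> blinfun_apply B ` range (blinfun_apply Q)"
    and fibers: "\<And>y. y \<in> range (blinfun_apply Q) \<Longrightarrow>
       {x. blinfun_apply Q' x = 0} \<subseteq> (\<lambda>x. blinfun_apply B x + f (x + y)) ` {x. blinfun_apply Q x = 0}"
  shows "surj (\<lambda>x. blinfun_apply B x + f x)"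
  unfolding surj_def
proof
  fix w
  from subsetD[OF onto rangeI[of "blinfun_apply Q'" w]]
  obtain y where y: "Q' w = B y" "y \<in> range (blinfun_apply Q)" by (rule imageE)

  have "Q' (w - Q' w) = 0"
    using arg_cong[OF proj(2), of "\<lambda>T. T w"] by (simp add: blinfun.diff_right)
  then have "w - Q' w \<in> (\<lambda>x. B x + f (x + y)) ` {x. Q x = 0}" using subsetD[OF fibers[OF y(2)]] by simp
  then obtain x where "w - Q' w = B x + f (x + y)" by (rule imageE)
  then have "w = B (x + y) + f (x + y)" using y(1) by (simp add: blinfun.add_right algebra_simps)
  then show "\<exists>x. w = B x + f x" ..
qed

lemma sup_norm_le_iff: "sup_norm h \<le> ereal c \<longleftrightarrow> (\<forall>x. norm (h x) \<le> c)"
  unfolding sup_norm_def SUP_le_iff by simp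

lemma add_powr_le:
  fixes t R \<alpha> :: real
  assumes "0 \<le> t" "t \<le> R" "1 \<le> R" "0 < \<alpha>" "\<alpha> < 1"
  shows "t + t powr \<alpha> \<le> (R + 1) * t powr \<alpha>"
proof (cases "t = 0")
  case False
  then have "t = t powr (1 - \<alpha>) * t powr \<alpha>" using assms by (simp flip: powr_add)
  also have "\<dots> \<le> R powr (1 - \<alpha>) * t powr \<alpha>" using assms by (intro mult_right_mono powr_mono2) auto
  also have "\<dots> \<le> R powr 1 * t powr \<alpha>" using assms by (intro mult_right_mono powr_mono) auto
  finally show ?thesis using assms by (simp add: algebra_simps)
qed simp

text \<open>The deviation from the identity needs no bound on the distance; \<open>R\<close> serves
  to dominate the identity part, which is Lipschitz, by a Hoelder term.\<close>

lemma holder_of_difference: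
  fixes h :: "'a::real_normed_vector \<Rightarrow> 'a"
  assumes "norm ((h x - x) - (h z - z)) \<le> norm (x - z) powr \<alpha>"
    and "norm (x - z) \<le> R" "1 \<le> R" "0 < \<alpha>" "\<alpha> < 1"
  shows "norm (h x - h z) \<le> (R + 1) * norm (x - z) powr \<alpha>"
proof -
  have "norm (h x - h z) \<le> norm (x - z) + norm ((h x - x) - (h z - z))"
    using norm_triangle_ineq[of "x - z" "(h x - x) - (h z - z)"] by simp
  also have "\<dots> \<le> norm (x - z) + norm (x - z) powr \<alpha>" using assms(1) by simp
  also have "\<dots> \<le> (R + 1) * norm (x - z) powr \<alpha>" using assms by (intro add_powr_le) auto
  finally show ?thesis .
qed

lemma bounded_imp_norm_diff_le:
  fixes S :: "'a::real_normed_vector set"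
  assumes "bounded S"
  obtains R where "1 \<le> R" "\<And>x z. x \<in> S \<Longrightarrow> z \<in> S \<Longrightarrow> norm (x - z) \<le> R"
proof -
  obtain b where b: "\<And>x. x \<in> S \<Longrightarrow> norm x \<le> b" using assms by (auto simp: bounded_iff)
  have "norm (x - z) \<le> max 1 (2 * b)" if "x \<in> S" "z \<in> S" for x z
    using norm_triangle_ineq4[of x z] b[OF that(1)] b[OF that(2)] by linarith
  then show ?thesis using that [of "max 1 (2 * b)"] by simp
qed

section \<open>From the random cocycle to its generic orbits\<close>

context trichotomic_cocycle
begin

lemma cocycle_plus_1:
  assumes inv: "\<And>n. op_invertible (A (iter n \<omega>))"
  shows "cocycle M \<sigma> A \<omega> (j + 1) = A (iter j \<omega>) o\<^sub>L cocycle M \<sigma> A \<omega> j"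
proof (cases "0 \<le> j")
  case True
  then have "nat (j + 1) = Suc (nat j)" by simp
  then show ?thesis using True by (simp add: cocycle_def base_iter_def)
next
  case False
  define k where "k = nat (- j - 1)"
  have j: "nat (- j) = Suc k" using False by (simp add: k_def)
  have "iter j \<omega> = (base_inv M \<sigma> ^^ Suc k) \<omega>" using False j by (simp add: base_iter_def)
  then have "cocycle M \<sigma> A \<omega> j = op_inv (A (iter j \<omega>)) o\<^sub>L cocycle_bwd M \<sigma> A \<omega> k"
    using False j by (simp add: cocycle_def)
  then have "A (iter j \<omega>) o\<^sub>L cocycle M \<sigma> A \<omega> j = cocycle_bwd M \<sigma> A \<omega> k"
    using op_inverse_of_op_inv[OF inv[of j]]
    by (simp add: op_inverse_of_def flip: blinfun_compose_assoc)
  also have "\<dots> = cocycle M \<sigma> A \<omega> (j + 1)"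
    \<comment> \<open>At \<open>j = -1\<close> the successor 0 already lies in the forward branch of
      the definition; both branches give the identity there.\<close>
    using False by (cases "j = -1") (auto simp: cocycle_def k_def)
  finally show ?thesis ..
qed

definition orbit_evolution :: "'w \<Rightarrow> int \<Rightarrow> int \<Rightarrow> 'a \<Rightarrow>\<^sub>L 'a" where
  "orbit_evolution \<omega> m n = cocycle M \<sigma> A (iter n \<omega>) (m - n)"

lemma orbit_evolution_refl: "orbit_evolution \<omega> n n = id_blinfun"
  by (simp add: orbit_evolution_def cocycle_def)

lemma orbit_evolution_plus_1:
  assumes w: "\<omega> \<in> space M" and inv: "\<And>n. op_invertible (A (iter n \<omega>))"
  shows "orbit_evolution \<omega> (m + 1) n = A (iter m \<omega>) o\<^sub>L orbit_evolution \<omega> m n"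
  using cocycle_plus_1[of "iter n \<omega>" "m - n"] inv
  by (simp add: orbit_evolution_def iter_iter[OF w] algebra_simps)

text \<open>Along almost every orbit \<open>K \<le> Z \<le> W\<close>, so \<open>W\<close> can
  replace both constants in the growth and contraction bounds.\<close>

lemma AE_orbit_trichotomy:
  assumes W1: "\<And>\<omega>. 1 \<le> W \<omega>" and ZW: "AE \<omega> in M. Z \<omega> \<le> W \<omega>"
    and slow: "AE \<omega> in M. \<forall>n m. W (iter n \<omega>) \<le> W (iter m \<omega>) * exp (eps * \<bar>of_int (n - m)\<bar>)"
    and eps: "0 < eps" "2 * eps < lam"
  shows "AE \<omega> in M. slowly_varying_trichotomy (orbit_evolution \<omega>)
    (\<lambda>n. P 1 (iter n \<omega>)) (\<lambda>n. P 3 (iter n \<omega>)) (\<lambda>n. W (iter n \<omega>)) lam rho eps"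
proof -
  have "AE \<omega> in M. \<forall>n. op_invertible (A (iter n \<omega>))"
    by (rule AE_iter[OF A_invertible])
  moreover have "AE \<omega> in M. \<forall>n. A (iter n \<omega>) o\<^sub>L P 1 (iter n \<omega>) = P 1 (\<sigma> (iter n \<omega>)) o\<^sub>L A (iter n \<omega>)"
    using AE_iter[OF P_invariant[of 1]] by simp
  moreover have "AE \<omega> in M. \<forall>n. A (iter n \<omega>) o\<^sub>L P 3 (iter n \<omega>) = P 3 (\<sigma> (iter n \<omega>)) o\<^sub>L A (iter n \<omega>)"
    using AE_iter[OF P_invariant[of 3]] by simp
  moreover have "AE \<omega> in M. \<forall>n. K (iter n \<omega>) \<le> Z (iter n \<omega>)" by (rule AE_iter[OF K_le_Z])
  moreover have "AE \<omega> in M. \<forall>n. Z (iter n \<omega>) \<le> W (iter n \<omega>)" by (rule AE_iter[OF ZW])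
  moreover note AE_iter[OF stable_bound] AE_iter[OF unstable_bound] AE_iter[OF growth_bound] AE_space slow
  ultimately show ?thesis
  proof eventually_elim
    case (elim \<omega>)
    note inv = elim(1)[rule_format] and w = elim(9)
    note step = orbit_evolution_plus_1[OF w inv]
    have comm: "A (iter m \<omega>) o\<^sub>L P 1 (iter m \<omega>) = P 1 (iter (m + 1) \<omega>) o\<^sub>L A (iter m \<omega>)"
      "A (iter m \<omega>) o\<^sub>L P 3 (iter m \<omega>) = P 3 (iter (m + 1) \<omega>) o\<^sub>L A (iter m \<omega>)" for m
      using elim(2,3) by (simp_all add: iter_plus_1[OF w])
    have KW: "K (iter n \<omega>) \<le> W (iter n \<omega>)" for n using elim(4,5) order_trans by blast
    show ?case
    proof
      fix l m n :: int and k :: nat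
      show "orbit_evolution \<omega> n n = id_blinfun" by (rule orbit_evolution_refl)
      show "orbit_evolution \<omega> l m o\<^sub>L orbit_evolution \<omega> m n = orbit_evolution \<omega> l n"
        by (rule evolution_family_trans[where U = "orbit_evolution \<omega>" and B = "\<lambda>m. A (iter m \<omega>)", OF orbit_evolution_refl step inv])
      show "P 1 (iter m \<omega>) o\<^sub>L orbit_evolution \<omega> m n = orbit_evolution \<omega> m n o\<^sub>L P 1 (iter n \<omega>)"
        by (rule evolution_family_commute[where U = "orbit_evolution \<omega>" and B = "\<lambda>m. A (iter m \<omega>)", OF orbit_evolution_refl step inv, where Q = "\<lambda>n. P 1 (iter n \<omega>)"]) (rule comm)
      show "P 3 (iter m \<omega>) o\<^sub>L orbit_evolution \<omega> m n = orbit_evolution \<omega> m n o\<^sub>L P 3 (iter n \<omega>)"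
        by (rule evolution_family_commute[where U = "orbit_evolution \<omega>" and B = "\<lambda>m. A (iter m \<omega>)", OF orbit_evolution_refl step inv, where Q = "\<lambda>n. P 3 (iter n \<omega>)"]) (rule comm)
      show "1 \<le> W (iter n \<omega>)" by (rule W1)
      show "W (iter n \<omega>) \<le> W (iter m \<omega>) * exp (eps * \<bar>of_int (n - m)\<bar>)" using elim(10) by blast
      have "norm (orbit_evolution \<omega> m n) \<le> Z (iter n \<omega>) * exp (rho * \<bar>of_int (m - n)\<bar>)"
        using elim(8) unfolding orbit_evolution_def by blast
      also have "\<dots> \<le> W (iter n \<omega>) * exp (rho * \<bar>of_int (m - n)\<bar>)"
        using elim(5) by (intro mult_right_mono) auto
      finally show "norm (orbit_evolution \<omega> m n) \<le> W (iter n \<omega>) * exp (rho * \<bar>of_int (m - n)\<bar>)" .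
      have "norm (orbit_evolution \<omega> (n + int k) n o\<^sub>L P 1 (iter n \<omega>)) \<le> K (iter n \<omega>) * exp (- lam * real k)"
        using elim(6) by (simp add: orbit_evolution_def)
      also have "\<dots> \<le> W (iter n \<omega>) * exp (- lam * real k)"
        using KW by (intro mult_right_mono) auto
      finally show "norm (orbit_evolution \<omega> (n + int k) n o\<^sub>L P 1 (iter n \<omega>)) \<le> W (iter n \<omega>) * exp (- lam * real k)" .
      have "norm (orbit_evolution \<omega> (n - int k) n o\<^sub>L P 3 (iter n \<omega>)) \<le> K (iter n \<omega>) * exp (- lam * real k)"
        using elim(7) by (simp add: orbit_evolution_def)
      also have "\<dots> \<le> W (iter n \<omega>) * exp (- lam * real k)"
        using KW by (intro mult_right_mono) auto
      finally show "norm (orbit_evolution \<omega> (n - int k) n o\<^sub>L P 3 (iter n \<omega>)) \<le> W (iter n \<omega>) * exp (- lam * real k)" .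
    qed (use lam_pos rho_pos eps in auto)
  qed
qed

text \<open>The deterministic estimate is applied at time 0 of a generic orbit, once to
  \<open>H\<close> and once to its inverse, which conjugates the two perturbed systems in the
  opposite direction.\<close>

lemma AE_conjugacy_holder:
  assumes W1: "\<And>\<omega>. 1 \<le> W \<omega>" and ZW: "AE \<omega> in M. Z \<omega> \<le> W \<omega>" and DW: "AE \<omega> in M. D \<omega> \<le> W \<omega>"
    and slow: "AE \<omega> in M. \<forall>n m. W (iter n \<omega>) \<le> W (iter m \<omega>) * exp (eps * \<bar>of_int (n - m)\<bar>)"
    and eps: "0 < eps" "2 * eps < lam"
    and \<alpha>: "0 < \<alpha>" "\<alpha> < 1"
    and \<kappa>: "0 < \<kappa>" "\<kappa> = lam - \<alpha> * (rho + eps) - eps"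
    and d: "\<And>\<omega>. 0 < d \<omega>" "\<And>\<omega>. d \<omega> \<le> 1"
    and d_growth: "\<And>\<omega>. exp (rho + eps) * W \<omega> * d \<omega> \<le> 1 - exp (- eps)"
    and d_small: "\<And>\<omega>. 5 * exp (lam + 2 * eps) * W \<omega> ^ 3 * d \<omega> powr \<alpha> \<le> (1 - exp (- \<kappa>)) / 4"
    and adm: "admissible_pair M \<sigma> A P K c D f g"
    and lip: "AE \<omega> in M. \<forall>x z. norm (f \<omega> x - f \<omega> z) \<le> d \<omega> * norm (x - z) \<and>
                norm (g \<omega> x - g \<omega> z) \<le> d \<omega> * norm (x - z)"
    and H: "linearizing_conjugacy M \<sigma> A P f g H"
  shows "AE \<omega> in M. \<forall>x z. norm ((H \<omega> x - x) - (H \<omega> z - z)) \<le> norm (x - z) powr \<alpha> \<and>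
     norm ((inv (H \<omega>) x - x) - (inv (H \<omega>) z - z)) \<le> norm (x - z) powr \<alpha>"
proof -
  \<comment> \<open>Most of the almost sure conditions are bundled so that they pass to the whole
    orbit together.\<close>
  define Q where "Q \<omega> \<longleftrightarrow> id_blinfun = P 1 \<omega> + P 2 \<omega> + P 3 \<omega> \<and>
    bij_betw (blinfun_apply (A \<omega>)) (range (blinfun_apply (P 2 \<omega>))) (range (blinfun_apply (P 2 (\<sigma> \<omega>)))) \<and>
    D \<omega> \<le> W \<omega> \<and> max (sup_norm (f \<omega>)) (sup_norm (g \<omega>)) \<le> ereal (D \<omega>) \<and>
    (\<forall>y\<in>Ec P \<omega>.
        bij_betw (\<lambda>x. blinfun_apply (A \<omega>) x + f \<omega> (x + y)) (Esu P \<omega>) (Esu P (\<sigma> \<omega>)) \<and>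
        bij_betw (\<lambda>x. blinfun_apply (A \<omega>) x + g \<omega> (x + y)) (Esu P \<omega>) (Esu P (\<sigma> \<omega>))) \<and>
    (\<forall>x z. norm (f \<omega> x - f \<omega> z) \<le> d \<omega> * norm (x - z) \<and> norm (g \<omega> x - g \<omega> z) \<le> d \<omega> * norm (x - z)) \<and>
    H (\<sigma> \<omega>) \<circ> (\<lambda>x. blinfun_apply (A \<omega>) x + f \<omega> x) = (\<lambda>x. blinfun_apply (A \<omega>) x + g \<omega> x) \<circ> H \<omega> \<and>
    (\<forall>x. H \<omega> x - x \<in> Esu P \<omega>) \<and> op_invertible (A \<omega>)" for \<omega>
  have bij2: "AE \<omega> in M. bij_betw (blinfun_apply (A \<omega>)) (range (blinfun_apply (P 2 \<omega>))) (range (blinfun_apply (P 2 (\<sigma> \<omega>))))"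
    by (rule A_invertible_on_range) simp
  note adm' = adm[unfolded admissible_pair_def] and H' = H[unfolded linearizing_conjugacy_def]
  have "AE \<omega> in M. Q \<omega>"
    using P_sum bij2 DW lip A_invertible adm'[THEN conjunct2, THEN conjunct2, THEN conjunct2, THEN conjunct1]
      adm'[THEN conjunct2, THEN conjunct2, THEN conjunct2, THEN conjunct2, THEN conjunct2]
      H'[THEN conjunct2, THEN conjunct1] H'[THEN conjunct2, THEN conjunct2, THEN conjunct2, THEN conjunct2]
    by eventually_elim (unfold Q_def, intro conjI)
  then have AE_Q: "AE \<omega> in M. \<forall>n. Q (iter n \<omega>)" by (rule AE_iter)
  obtain T where T: "tempered M \<sigma> T" "AE \<omega> in M. sup_norm (\<lambda>x. H \<omega> x - x) \<le> ereal (T \<omega>)"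
    using H by (auto simp: linearizing_conjugacy_def)
  show ?thesis
    using AE_Q AE_iter[OF T(2)] tempered_imp_subexponential[OF T(1)] AE_space
      AE_orbit_trichotomy[OF W1 ZW slow eps]
  proof eventually_elim
    case (elim \<omega>)
    note w = elim(4)
    define f' g' H' where "f' n = f (iter n \<omega>)" and "g' n = g (iter n \<omega>)" and "H' n = H (iter n \<omega>)" for n
    define U where "U = orbit_evolution \<omega>"
    have inv: "op_invertible (A (iter n \<omega>))" for n using elim(1) by (simp add: Q_def)
    have U1: "U (m + 1) m = A (iter m \<omega>)" for m
      by (simp add: U_def orbit_evolution_plus_1[OF w inv] orbit_evolution_refl)
    interpret slowly_varying_trichotomy U "\<lambda>n. P 1 (iter n \<omega>)" "\<lambda>n. P 3 (iter n \<omega>)" "\<lambda>n. W (iter n \<omega>)" lam rho eps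
      unfolding U_def by (rule elim(5))
    obtain C where C: "\<And>n. T (iter n \<omega>) \<le> C * exp (eps * \<bar>of_int n\<bar>)" using elim(3) eps by blast
    have tame: "norm (H' n x - x) \<le> C * exp (eps * \<bar>of_int n\<bar>)" for n x
    proof -
      have "norm (H' n x - x) \<le> T (iter n \<omega>)"
        using elim(2) unfolding sup_norm_le_iff H'_def by blast
      with C[of n] show ?thesis by linarith
    qed
    have bij: "bij (H' n)" for n
    proof -
      obtain G where "homeomorphism UNIV UNIV (H' n) G"
        using H iter_in_space[OF w, of n] unfolding linearizing_conjugacy_def H'_def by blast
      then show ?thesis unfolding homeomorphism_def by (intro o_bij[of G]) auto
    qed
    have conj: "H' (m + 1) (U (m + 1) m x + f' m x) = U (m + 1) m (H' m x) + g' m (H' m x)" for m x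
    proof -
      have "H (\<sigma> (iter m \<omega>)) \<circ> (\<lambda>x. blinfun_apply (A (iter m \<omega>)) x + f (iter m \<omega>) x) = (\<lambda>x. blinfun_apply (A (iter m \<omega>)) x + g (iter m \<omega>) x) \<circ> H (iter m \<omega>)"
        using elim(1) by (simp add: Q_def)
      then show ?thesis by (auto simp: U1 f'_def g'_def H'_def iter_plus_1[OF w] fun_eq_iff)
    qed
    have surj: "surj (\<lambda>x. U (m + 1) m x + f' m x)" "surj (\<lambda>x. U (m + 1) m x + g' m x)" for m
    proof -
      have Qm: "Q (iter m \<omega>)" using elim(1) by blast
      have idem: "P 2 (iter n \<omega>) o\<^sub>L P 2 (iter n \<omega>) = P 2 (iter n \<omega>)" for n
        using P_projection[of 2] iter_in_space[OF w] by simp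
      have onto: "range (blinfun_apply (P 2 (iter (m + 1) \<omega>))) \<subseteq> blinfun_apply (A (iter m \<omega>)) ` range (blinfun_apply (P 2 (iter m \<omega>)))"
        using Qm by (auto simp: Q_def bij_betw_def iter_plus_1[OF w])
      show "surj (\<lambda>x. U (m + 1) m x + f' m x)"
        unfolding U1 f'_def using Qm
        by (intro surj_of_onto_fibers[OF idem idem onto])
          (auto simp: Q_def bij_betw_def Ec_def Esu_def iter_plus_1[OF w])
      show "surj (\<lambda>x. U (m + 1) m x + g' m x)"
        unfolding U1 g'_def using Qm
        by (intro surj_of_onto_fibers[OF idem idem onto])
          (auto simp: Q_def bij_betw_def Ec_def Esu_def iter_plus_1[OF w])
    qed
    have bdd: "norm (f' m x) \<le> W (iter m \<omega>)" "norm (g' m x) \<le> W (iter m \<omega>)" for m x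
    proof -
      have "D (iter m \<omega>) \<le> W (iter m \<omega>)" "norm (f' m x) \<le> D (iter m \<omega>)" "norm (g' m x) \<le> D (iter m \<omega>)"
        using elim(1) unfolding Q_def max.bounded_iff sup_norm_le_iff f'_def g'_def by blast+
      then show "norm (f' m x) \<le> W (iter m \<omega>)" "norm (g' m x) \<le> W (iter m \<omega>)" by linarith+
    qed
    have lip': "norm (f' m x - f' m z) \<le> d (iter m \<omega>) * norm (x - z)"
      "norm (g' m x - g' m z) \<le> d (iter m \<omega>) * norm (x - z)" for m x z
      using elim(1) unfolding Q_def f'_def g'_def by blast+
    have split: "H' m x - x = P 1 (iter m \<omega>) (H' m x - x) + P 3 (iter m \<omega>) (H' m x - x)" for m x
    proof -
      have P2: "P 2 (iter m \<omega>) (H' m x - x) = 0" and id: "id_blinfun = P 1 (iter m \<omega>) + P 2 (iter m \<omega>) + P 3 (iter m \<omega>)"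
        using elim(1) by (auto simp: Q_def Esu_def H'_def)
      have "id_blinfun (H' m x - x) = P 1 (iter m \<omega>) (H' m x - x) + P 2 (iter m \<omega>) (H' m x - x) + P 3 (iter m \<omega>) (H' m x - x)"
        by (subst id) (simp only: blinfun.add_left)
      with P2 show ?thesis by simp
    qed
    define G where "G n = inv (H' n)" for n
    have HG: "H' n (G n x) = x" and GH: "G n (H' n x) = x" for n x
      using bij[of n] by (simp_all add: G_def bij_def surj_f_inv_f inv_f_f)
    \<comment> \<open>The displacement of the inverse is minus that of \<open>H'\<close> at another
      point, so the splitting and the growth bound carry over.\<close>
    have G_diff: "G n x - x = - (H' n (G n x) - G n x)" for n x by (simp add: HG)
    have "norm ((H' 0 x - x) - (H' 0 z - z)) \<le> norm (x - z) powr \<alpha>" for x z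
      by (rule conjugacy_holder[where H = H' and f = f' and g = g' and d = "\<lambda>n. d (iter n \<omega>)",
            OF conj surj(1) bdd lip' split tame \<alpha> \<kappa> d d_growth d_small])
    moreover have "norm ((G 0 x - x) - (G 0 z - z)) \<le> norm (x - z) powr \<alpha>" for x z
    proof (rule conjugacy_holder[where H = G and f = g' and g = f' and d = "\<lambda>n. d (iter n \<omega>)",
            OF _ surj(2) bdd(2,1) lip'(2,1) _ _ \<alpha> \<kappa> d d_growth d_small])
      fix m x
      show "G (m + 1) (U (m + 1) m x + g' m x) = U (m + 1) m (G m x) + f' m (G m x)"
        using conj[of m "G m x"] GH[of "m + 1" "U (m + 1) m (G m x) + f' m (G m x)"] by (simp add: HG)
      show "G m x - x = P 1 (iter m \<omega>) (G m x - x) + P 3 (iter m \<omega>) (G m x - x)"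
        unfolding G_diff blinfun.minus_right minus_add_distrib[symmetric] neg_equal_iff_equal by (rule split)
      show "norm (G m x - x) \<le> C * exp (eps * \<bar>of_int m\<bar>)"
        unfolding G_diff norm_minus_cancel by (rule tame)
    qed
    ultimately show ?case by (simp add: H'_def G_def)
  qed
qed

end

theorem theorem2:
  fixes M :: "'w measure" and \<sigma> :: "'w \<Rightarrow> 'w"
    and A :: "'w \<Rightarrow> 'a::banach \<Rightarrow>\<^sub>L 'a" and P :: "nat \<Rightarrow> 'w \<Rightarrow> 'a \<Rightarrow>\<^sub>L 'a"
    and lam rho c \<alpha> :: real and K Z D :: "'w \<Rightarrow> real"
  assumes "trichotomic_cocycle M \<sigma> A P lam rho K Z"
    and "tempered M \<sigma> D" and "\<And>\<omega>. \<omega> \<in> space M \<Longrightarrow> 1 \<le> D \<omega>"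
    and "0 < c" and "small_for_linearization M \<sigma> A P K D c"
    and "0 < \<alpha>" and "\<alpha> < lam / rho"
  shows "\<exists>d. tempered M \<sigma> d \<and>
    (\<forall>f g H.
       admissible_pair M \<sigma> A P K c D f g \<longrightarrow>
       (AE \<omega> in M. \<forall>x z. norm (f \<omega> x - f \<omega> z) \<le> d \<omega> * norm (x - z) \<and>
                          norm (g \<omega> x - g \<omega> z) \<le> d \<omega> * norm (x - z)) \<longrightarrow>
       linearizing_conjugacy M \<sigma> A P f g H \<longrightarrow>
       (AE \<omega> in M. \<forall>S. bounded S \<longrightarrow> holder_on \<alpha> S (H \<omega>) \<and> holder_on \<alpha> S (inv (H \<omega>)))) \<and>
    (\<forall>S. bounded S \<longrightarrow>
       (\<exists>T>0. \<forall>f g H.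
          admissible_pair M \<sigma> A P K c D f g \<longrightarrow>
          (AE \<omega> in M. \<forall>x z. norm (f \<omega> x - f \<omega> z) \<le> d \<omega> * norm (x - z) \<and>
                             norm (g \<omega> x - g \<omega> z) \<le> d \<omega> * norm (x - z)) \<longrightarrow>
          linearizing_conjugacy M \<sigma> A P f g H \<longrightarrow>
          (AE \<omega> in M. \<forall>x\<in>S. \<forall>z\<in>S.
             norm (H \<omega> x - H \<omega> z) \<le> T * norm (x - z) powr \<alpha> \<and>
             norm (inv (H \<omega>) x - inv (H \<omega>) z) \<le> T * norm (x - z) powr \<alpha>)))"
proof -
  interpret trichotomic_cocycle M \<sigma> A P lam rho K Z by (rule assms(1))
  have \<alpha>rho: "\<alpha> * rho < lam" using assms(7) rho_pos by (simp add: pos_less_divide_eq)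
  have "lam / rho \<le> 1" using lam_le_rho rho_pos by simp
  with assms(6,7) have \<alpha>: "0 < \<alpha>" "\<alpha> < 1" by auto
  \<comment> \<open>A quarter of the spectral gap: \<kappa> gives up \<open>eps\<close> and
    \<open>\<alpha> * eps\<close> from \<open>4 * eps\<close>, which leaves at least
    \<open>2 * eps\<close>.\<close>
  define eps where "eps = (lam - \<alpha> * rho) / 4"
  define \<kappa> where "\<kappa> = lam - \<alpha> * (rho + eps) - eps"
  have eps: "0 < eps" "2 * eps < lam"
    using \<alpha>rho mult_pos_pos[OF \<alpha>(1) rho_pos] lam_pos by (auto simp: eps_def)
  have "\<alpha> * eps \<le> eps" using \<alpha> eps by simp
  moreover have "lam - \<alpha> * rho = 4 * eps" by (simp add: eps_def)
  ultimately have \<kappa>: "0 < \<kappa>" using eps unfolding \<kappa>_def distrib_left by linarith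
  \<comment> \<open>Since \<open>Z\<close> and \<open>D\<close> are at least 1, their product
    dominates both.\<close>
  obtain W where W: "tempered M \<sigma> W" "\<And>\<omega>. 1 \<le> W \<omega>" "AE \<omega> in M. Z \<omega> * D \<omega> \<le> W \<omega>"
    "AE \<omega> in M. \<forall>n m. W (iter n \<omega>) \<le> W (iter m \<omega>) * exp (eps * \<bar>of_int (n - m)\<bar>)"
    by (rule ex_slowly_varying_majorant[OF tempered_mult[OF Z_tempered assms(2)] eps(1)], rule that)
  have ZDW: "AE \<omega> in M. Z \<omega> \<le> W \<omega> \<and> D \<omega> \<le> W \<omega>"
    using W(3) AE_space
  proof eventually_elim
    case (elim \<omega>)
    have "Z \<omega> * 1 \<le> Z \<omega> * D \<omega>" "1 * D \<omega> \<le> Z \<omega> * D \<omega>"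
      using Z_ge_1[OF elim(2)] assms(3)[OF elim(2)] by (intro mult_mono; simp)+
    then show ?case using elim(1) by simp
  qed
  \<comment> \<open>The three entries yield \<open>d \<le> 1\<close>, \<open>d_small\<close> and
    \<open>d_growth\<close>, in this order.\<close>
  define \<mu> where "\<mu> = min 1 (min ((1 - exp (- \<kappa>)) / 4 / (5 * exp (lam + 2 * eps))) ((1 - exp (- eps)) / exp (rho + eps)))"
  \<comment> \<open>The exponent makes \<open>d powr \<alpha>\<close> equal to
    \<open>\<mu> / W ^ 3\<close>, cancelling the cube in \<open>d_small\<close>. As
    \<open>1 / \<alpha>\<close> exceeds 1 and the base is at most 1, \<open>d\<close> itself is at
    most \<open>\<mu> / W ^ 3\<close>, which serves \<open>d_growth\<close>.\<close>
  define d where "d \<omega> = (\<mu> / W \<omega> ^ 3) powr (1 / \<alpha>)" for \<omega>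
  have \<mu>: "0 < \<mu>" "\<mu> \<le> 1" "\<mu> \<le> (1 - exp (- \<kappa>)) / 4 / (5 * exp (lam + 2 * eps))"
    "\<mu> \<le> (1 - exp (- eps)) / exp (rho + eps)"
    using \<kappa> eps by (auto simp: \<mu>_def)
  have Wpos: "0 < W \<omega>" for \<omega> using W(2)[of \<omega>] by linarith
  have d_powr: "d \<omega> powr \<alpha> = \<mu> / W \<omega> ^ 3" for \<omega>
    using \<alpha> \<mu>(1) Wpos[of \<omega>] by (simp add: d_def powr_powr)
  have quot: "0 < \<mu> / W \<omega> ^ 3" "\<mu> / W \<omega> ^ 3 \<le> 1" for \<omega>
  proof -
    show "0 < \<mu> / W \<omega> ^ 3" using \<mu>(1) Wpos[of \<omega>] by simp
    have "\<mu> / W \<omega> ^ 3 \<le> 1 / 1"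
      using \<mu>(1,2) one_le_power[OF W(2)] by (intro frac_le) auto
    then show "\<mu> / W \<omega> ^ 3 \<le> 1" by simp
  qed
  have d_pos: "0 < d \<omega>" for \<omega> using \<mu>(1) Wpos[of \<omega>] by (auto simp: d_def)
  have "d \<omega> \<le> (\<mu> / W \<omega> ^ 3) powr 1" for \<omega>
    unfolding d_def using quot[of \<omega>] \<alpha> by (intro powr_mono') auto
  moreover have "(\<mu> / W \<omega> ^ 3) powr 1 = \<mu> / W \<omega> ^ 3" for \<omega>
    using quot[of \<omega>] by (intro powr_one) auto
  ultimately have d_le: "d \<omega> \<le> \<mu> / W \<omega> ^ 3" for \<omega> by metis
  have d_growth: "exp (rho + eps) * W \<omega> * d \<omega> \<le> 1 - exp (- eps)" for \<omega>
  proof -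
    have "W \<omega> * d \<omega> \<le> W \<omega> * (\<mu> / W \<omega> ^ 3)"
      using d_le Wpos[of \<omega>] by (intro mult_left_mono) auto
    also have "\<dots> = \<mu> / W \<omega> ^ 2" using Wpos[of \<omega>] by (simp add: power2_eq_square power3_eq_cube)
    also have "\<dots> \<le> \<mu> / 1" using \<mu>(1) W(2)[of \<omega>] by (intro divide_left_mono) (auto simp: one_le_power Wpos)
    finally have "W \<omega> * d \<omega> \<le> (1 - exp (- eps)) / exp (rho + eps)" using \<mu>(4) by simp
    then show ?thesis by (simp add: pos_le_divide_eq mult_ac)
  qed
  have d_small: "5 * exp (lam + 2 * eps) * W \<omega> ^ 3 * d \<omega> powr \<alpha> \<le> (1 - exp (- \<kappa>)) / 4" for \<omega>
  proof -
    have "5 * exp (lam + 2 * eps) * W \<omega> ^ 3 * d \<omega> powr \<alpha> = \<mu> * (5 * exp (lam + 2 * eps))"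
      unfolding d_powr using Wpos[of \<omega>] by simp
    also have "\<dots> \<le> (1 - exp (- \<kappa>)) / 4" by (rule iffD1[OF pos_le_divide_eq \<mu>(3)]) simp
    finally show ?thesis .
  qed
  have d_1: "d \<omega> \<le> 1" for \<omega> using d_le[of \<omega>] quot[of \<omega>] by linarith
  have ZW: "AE \<omega> in M. Z \<omega> \<le> W \<omega>" and DW: "AE \<omega> in M. D \<omega> \<le> W \<omega>" using ZDW by auto
  note holder = AE_conjugacy_holder[OF W(2) ZW DW W(4) eps \<alpha> \<kappa> \<kappa>_def d_pos d_1 d_growth d_small]
  show ?thesis
  proof (intro exI[of _ d] conjI allI impI)
    show "tempered M \<sigma> d" unfolding d_def by (rule tempered_powr[OF W(1) \<mu>(1)])
  next
    fix f g H
    assume "admissible_pair M \<sigma> A P K c D f g"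
      "AE \<omega> in M. \<forall>x z. norm (f \<omega> x - f \<omega> z) \<le> d \<omega> * norm (x - z) \<and> norm (g \<omega> x - g \<omega> z) \<le> d \<omega> * norm (x - z)"
      "linearizing_conjugacy M \<sigma> A P f g H"
    \<comment> \<open>The estimate on the displacement is global, so one null set serves all bounded
      \<open>S\<close>.\<close>
    from holder[OF this] show "AE \<omega> in M. \<forall>S. bounded S \<longrightarrow> holder_on \<alpha> S (H \<omega>) \<and> holder_on \<alpha> S (inv (H \<omega>))"
    proof eventually_elim
      case (elim \<omega>)
      show ?case
      proof (intro allI impI)
        fix S :: "'a set" assume "bounded S"
        obtain R where R: "1 \<le> R" "\<And>x z. x \<in> S \<Longrightarrow> z \<in> S \<Longrightarrow> norm (x - z) \<le> R"
          by (rule bounded_imp_norm_diff_le[OF \<open>bounded S\<close>], rule that)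
        show "holder_on \<alpha> S (H \<omega>) \<and> holder_on \<alpha> S (inv (H \<omega>))"
          unfolding holder_on_def
          using elim R \<alpha> by (intro conjI exI[of _ "R + 1"] ballI holder_of_difference) auto
      qed
    qed
  next
    fix S :: "'a set" assume "bounded S"
    obtain R where R: "1 \<le> R" "\<And>x z. x \<in> S \<Longrightarrow> z \<in> S \<Longrightarrow> norm (x - z) \<le> R"
      by (rule bounded_imp_norm_diff_le[OF \<open>bounded S\<close>], rule that)
    show "\<exists>T>0. \<forall>f g H. admissible_pair M \<sigma> A P K c D f g \<longrightarrow>
          (AE \<omega> in M. \<forall>x z. norm (f \<omega> x - f \<omega> z) \<le> d \<omega> * norm (x - z) \<and>
                             norm (g \<omega> x - g \<omega> z) \<le> d \<omega> * norm (x - z)) \<longrightarrow>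
          linearizing_conjugacy M \<sigma> A P f g H \<longrightarrow>
          (AE \<omega> in M. \<forall>x\<in>S. \<forall>z\<in>S.
             norm (H \<omega> x - H \<omega> z) \<le> T * norm (x - z) powr \<alpha> \<and>
             norm (inv (H \<omega>) x - inv (H \<omega>) z) \<le> T * norm (x - z) powr \<alpha>)"
    \<comment> \<open>\<open>R\<close> bounds the distances within \<open>S\<close>, so the constant
      is independent of the pair, of \<open>H\<close> and of \<omega>.\<close>
    proof (intro exI[of _ "R + 1"] conjI allI impI)
      show "0 < R + 1" using R(1) by simp
      fix f g H
      assume "admissible_pair M \<sigma> A P K c D f g"
        "AE \<omega> in M. \<forall>x z. norm (f \<omega> x - f \<omega> z) \<le> d \<omega> * norm (x - z) \<and> norm (g \<omega> x - g \<omega> z) \<le> d \<omega> * norm (x - z)"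
        "linearizing_conjugacy M \<sigma> A P f g H"
      from holder[OF this] show "AE \<omega> in M. \<forall>x\<in>S. \<forall>z\<in>S.
         norm (H \<omega> x - H \<omega> z) \<le> (R + 1) * norm (x - z) powr \<alpha> \<and>
         norm (inv (H \<omega>) x - inv (H \<omega>) z) \<le> (R + 1) * norm (x - z) powr \<alpha>"
      proof eventually_elim
        case (elim \<omega>)
        then show ?case
          using R \<alpha> by (intro conjI ballI holder_of_difference) auto
      qed
    qed
  qed
qed

end
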